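(* Suppose $V$ is a distribution of $k$-planes in $\mathbb{R}^n$ of class $C^1$. Then there exists a $k$-dimensional submanifold $S$ of $\mathbb{R}^n$ of class $\bigcap_{0<\alpha<1}C^{1,\alpha}$ such that $$\mathscr{H}^k(\tau(S,V))>0 .$$
   Context: $\mathscr{H}^k$ is the $k$-dimensional Hausdorff measure. A distribution of $k$-planes $V$ on $\mathbb{R}^n$ assigns to each $x$ a $k$-dimensional linear subspace $V(x)\subset\mathbb{R}^n$; it is of class $C^1$ if it is locally spanned by $k$ vector fields of class $C^1$. The tangency set is $\tau(S,V):=\{x\in S:\mathrm{Tan}(S,x)=V(x)\}$, where $\mathrm{Tan}(S,x)$ is the classical tangent space of $S$ at $x$. Class $\bigcap_{0<\alpha<1}C^{1,\alpha}$ means of class $C^{1,\alpha}$ for every $\alpha\in(0,1)$. *)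

theory Defs
  imports "HOL-Analysis.Analysis"
begin

definition C1_on :: "'a::real_normed_vector set \<Rightarrow> ('a \<Rightarrow> 'b::real_normed_vector) \<Rightarrow> bool" where
  "C1_on U f \<longleftrightarrow> open U \<and>
     (\<exists>f'. (\<forall>x\<in>U. (f has_derivative blinfun_apply (f' x)) (at x)) \<and> continuous_on U f')"

text \<open>Since \<open>dim (V x) = k\<close>, the \<open>k\<close> spanning fields are automatically linearly independent at each
  point of \<open>U\<close>.\<close>

definition C1_plane_distribution :: "nat \<Rightarrow> ('a::euclidean_space \<Rightarrow> 'a set) \<Rightarrow> bool" where
  "C1_plane_distribution k V \<longleftrightarrow>
     (\<forall>x. subspace (V x) \<and> dim (V x) = k) \<and>
     (\<forall>p. \<exists>U X. open U \<and> p \<in> U \<and> (\<forall>i<k. C1_on U (X i)) \<and>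
        (\<forall>x\<in>U. V x = span {X i x | i. i < k}))"

text \<open>\<open>C\<^sup>1\<^sup>,\<^sup>\<alpha>\<close> is understood locally: the derivative is \<open>\<alpha>\<close>-Hoelder near every point.
  For \<open>\<alpha> > 0\<close> this makes the derivative continuous.\<close>

definition C1_holder_on ::
  "real \<Rightarrow> 'a::real_normed_vector set \<Rightarrow> ('a \<Rightarrow> 'b::real_normed_vector) \<Rightarrow> bool" where
  "C1_holder_on \<alpha> U f \<longleftrightarrow> open U \<and>
     (\<exists>f'. (\<forall>x\<in>U. (f has_derivative blinfun_apply (f' x)) (at x)) \<and>
        (\<forall>x\<in>U. \<exists>r>0. \<exists>C. \<forall>y\<in>ball x r \<inter> U. \<forall>z\<in>ball x r \<inter> U.
           norm (f' y - f' z) \<le> C * dist y z powr \<alpha>))"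

text \<open>Embedded submanifolds without boundary (neither closed nor connected in general):
  near each of its points the set is flattened onto an open piece of a \<open>k\<close>-dimensional linear
  subspace \<open>L\<close> by a diffeomorphism \<open>\<phi>\<close>, with inverse \<open>\<psi>\<close>, between open sets of the ambient space.\<close>

definition C1_holder_submanifold :: "real \<Rightarrow> nat \<Rightarrow> 'a::euclidean_space set \<Rightarrow> bool" where
  "C1_holder_submanifold \<alpha> k S \<longleftrightarrow>
     (\<forall>p\<in>S. \<exists>U W L. \<exists>\<phi> \<psi> :: 'a \<Rightarrow> 'a. open U \<and> p \<in> U \<and> open W \<and> homeomorphism U W \<phi> \<psi> \<and>
        C1_holder_on \<alpha> U \<phi> \<and> C1_holder_on \<alpha> W \<psi> \<and>
        subspace L \<and> dim L = k \<and> \<phi> ` (S \<inter> U) = L \<inter> W)"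

text \<open>The classical tangent space consists of the velocities at \<open>x\<close> of the \<open>C\<^sup>1\<close> curves lying in
  \<open>S\<close>.\<close>

definition tangent_space :: "'a::real_normed_vector set \<Rightarrow> 'a \<Rightarrow> 'a set" where
  "tangent_space S x =
     {v. \<exists>\<gamma> \<epsilon>. 0 < \<epsilon> \<and> \<gamma> C1_differentiable_on {-\<epsilon><..<\<epsilon>} \<and> \<gamma> ` {-\<epsilon><..<\<epsilon>} \<subseteq> S \<and>
        \<gamma> 0 = x \<and> (\<gamma> has_vector_derivative v) (at 0)}"

definition tangency_set ::
  "'a::real_normed_vector set \<Rightarrow> ('a \<Rightarrow> 'a set) \<Rightarrow> 'a set" where
  "tangency_set S V = {x \<in> S. tangent_space S x = V x}"

text \<open>Hausdorff measure (as an outer measure) with the normalization that makes it agree with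
  Lebesgue measure on \<open>k\<close>-dimensional space: \<open>unit_ball_vol k\<close> is the volume of the unit ball.
  Boundedness is required in covers because \<^const>\<open>diameter\<close> is a junk value on unbounded sets.
  The empty set is treated separately since it must have size 0 also when \<open>k = 0\<close>, whereas
  nonempty sets then have size 1.\<close>

definition hausdorff_gauge :: "nat \<Rightarrow> 'a::metric_space set \<Rightarrow> ennreal" where
  "hausdorff_gauge k E =
     (if E = {} then 0 else ennreal (unit_ball_vol (real k) * (diameter E / 2) ^ k))"

definition hausdorff_premeasure :: "nat \<Rightarrow> real \<Rightarrow> 'a::metric_space set \<Rightarrow> ennreal" where
  "hausdorff_premeasure k \<delta> A =
     (INF E \<in> {E :: nat \<Rightarrow> 'a set. A \<subseteq> (\<Union>i. E i) \<and> (\<forall>i. bounded (E i) \<and> diameter (E i) \<le> \<delta>)}.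
        \<Sum>i. hausdorff_gauge k (E i))"

definition hausdorff_measure :: "nat \<Rightarrow> 'a::metric_space set \<Rightarrow> ennreal" where
  "hausdorff_measure k A = (SUP \<delta> \<in> {0<..}. hausdorff_premeasure k \<delta> A)"

end

theory Submission
  imports Defs
begin

text \<open>The submanifold is the graph of a function that solves the overdetermined system for \<open>V\<close> on a
fat Cantor set, where Euler's scheme can be run simultaneously in all directions.

Near \<open>0\<close> the distribution is given by a Lipschitz family \<open>M\<close> of linear maps: for a suitable set
\<open>I\<close> of \<open>k\<close> coordinate vectors, with coordinate projection \<open>P\<close>, the plane \<open>V y\<close> is the graph of
\<open>M y\<close> over the span of \<open>I\<close> (\<open>plane_distribution_graph\<close>). If \<open>f\<close> maps into the other coordinates
and depends only on \<open>P x\<close>, then the graph of \<open>f\<close> is tangent to \<open>V\<close> above every \<open>x\<close> with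
\<open>f' x = M (P x + f x)\<close>. In general no \<open>f\<close> satisfies this on an open set, as \<open>V\<close> need not be
integrable; it is enough to satisfy it on a set of positive measure.

Cubes of half-width about \<open>2\<^sup>-\<^sup>n\<close> serve as cells of level \<open>n\<close>. A cell consists of \<open>2\<^sup>k\<close> cells of
level \<open>n + 1\<close> and a frame along its boundary, whose relative width is of order \<open>1/n\<^sup>2\<close>. On a cell
with centre \<open>c\<close> the \<open>n\<close>-th approximation is affine; its graph goes through a point \<open>z\<close> above \<open>c\<close>
and has there the correct slope \<open>M z\<close>. The next approximation replaces, in each subcell, this
slope by the correct one at the new centre. The new slope differs from the old one by only
\<open>O(2\<^sup>-\<^sup>n)\<close>, because \<open>M\<close> is Lipschitz and the old approximation is affine, hence contributes no error
of its own. The correction is cut off inside the frame of the subcell. The cutoff costs powers of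
the relative width, so the \<open>n\<close>-th correction has a derivative of size \<open>O(n\<^sup>2 2\<^sup>-\<^sup>n)\<close> with Lipschitz
constant \<open>O(n\<^sup>4)\<close> (\<open>C11_on_correction_geometric\<close>). By interpolation the \<open>\<alpha>\<close>-Hoelder constant of
this derivative is \<open>O(n\<^sup>4 2\<^sup>-\<^sup>n\<^sup>(\<^sup>1\<^sup>-\<^sup>\<alpha>\<^sup>))\<close>, which is summable for every \<open>\<alpha> < 1\<close>
(\<open>C11_series_holder\<close>).

A point that is in no frame has all cutoffs equal to \<open>1\<close>, so that the slopes telescope there to
the limit of \<open>M z\<close>, which is \<open>M (P x + f x)\<close> (\<open>graph_fun_on_cantor_points\<close>). These points form a
product of fat Cantor sets, of positive measure because the relative widths of the frames are
summable (\<open>emeasure_cantor_set\<close>). Projection onto the coordinates in \<open>I\<close> does not increase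
diameters, so the part of the graph above them has positive \<open>k\<close>-dimensional Hausdorff measure
(\<open>hausdorff_measure_pos_if_projection\<close>).\<close>

section \<open>Functions with Lipschitz derivative\<close>

text \<open>The derivative of a function glued from pieces is Lipschitz inside each piece. Along a segment
these local bounds chain up without loss in the constant.\<close>

lemma local_lipschitz_imp_global:
  fixes f :: "'a::real_normed_vector \<Rightarrow> 'b::real_normed_vector"
  assumes loc: "\<And>x. \<exists>U. open U \<and> x \<in> U \<and> (\<forall>y\<in>U. norm (f y - f x) \<le> D * norm (y - x))"
  shows "norm (f y - f x) \<le> D * norm (y - x)"
proof -
  define h where "h t = f (x + t *\<^sub>R (y - x))" for t :: real
  have cont: "isCont f z" for z
  proof -
    obtain U where U: "open U" "z \<in> U" "\<And>y. y \<in> U \<Longrightarrow> norm (f y - f z) \<le> D * norm (y - z)"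
      using loc[of z] by metis
    have "((\<lambda>y. f y - f z) \<longlongrightarrow> 0) (at z)"
    proof (rule tendsto_0_le[where K = D])
      show "((\<lambda>y. y - z) \<longlongrightarrow> 0) (at z)"
        by (rule LIM_zero[OF tendsto_ident_at])
      show "\<forall>\<^sub>F y in at z. norm (f y - f z) \<le> norm (y - z) * D"
        using eventually_at_in_open'[OF U(1,2)]
        by eventually_elim (use U(3) in \<open>simp add: mult.commute\<close>)
    qed
    then show ?thesis
      unfolding isCont_def by (rule LIM_zero_cancel)
  qed
  have "dist (h 1) (h 0) \<le> (D * norm (y - x)) * (1 - 0)"
  proof (rule locally_lipschitz_imp_lipschitz_aux)
    show "continuous_on {0..1} h"
      unfolding h_def
      by (intro continuous_at_imp_continuous_on ballI isCont_o2[OF _ cont]) (intro continuous_intros)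
  next
    fix t :: real assume t: "t \<in> {0..<1}"
    obtain U where U: "open U" "x + t *\<^sub>R (y - x) \<in> U"
      "\<And>y'. y' \<in> U \<Longrightarrow> norm (f y' - f (x + t *\<^sub>R (y - x))) \<le> D * norm (y' - (x + t *\<^sub>R (y - x)))"
      using loc[of "x + t *\<^sub>R (y - x)"] by metis
    have "((\<lambda>s. x + s *\<^sub>R (y - x)) \<longlongrightarrow> x + t *\<^sub>R (y - x)) (at_right t)"
      by (intro tendsto_intros)
    then have "\<forall>\<^sub>F s in at_right t. x + s *\<^sub>R (y - x) \<in> U"
      using U(1,2) by (rule topological_tendstoD)
    moreover have "\<forall>\<^sub>F s in at_right t. s \<in> {t<..<1}"
      using t by (intro eventually_at_right_real) auto
    ultimately have "\<forall>\<^sub>F s in at_right t. x + s *\<^sub>R (y - x) \<in> U \<and> s \<in> {t<..<1}"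
      by eventually_elim auto
    then obtain s where s: "x + s *\<^sub>R (y - x) \<in> U" "t < s" "s < 1"
      using eventually_happens'[OF trivial_limit_at_right_real] by fastforce
    have "(x + s *\<^sub>R (y - x)) - (x + t *\<^sub>R (y - x)) = (s - t) *\<^sub>R (y - x)"
      by (simp add: scaleR_left_diff_distrib)
    then have "norm ((x + s *\<^sub>R (y - x)) - (x + t *\<^sub>R (y - x))) = (s - t) * norm (y - x)"
      using s(2) by simp
    then show "\<exists>s\<in>{t<..1}. dist (h s) (h t) \<le> D * norm (y - x) * (s - t)"
      using U(3)[OF s(1)] s(2,3) unfolding h_def dist_norm
      by (intro bexI[of _ s]) (auto simp: mult_ac)
  qed auto
  then show ?thesis
    by (simp add: h_def dist_norm)
qed

definition total_deriv :: "('a::real_normed_vector \<Rightarrow> 'b::real_normed_vector) \<Rightarrow> 'a \<Rightarrow> 'a \<Rightarrow>\<^sub>L 'b" where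
  "total_deriv g x = Blinfun (frechet_derivative g (at x))"

lemma total_deriv_eq:
  assumes "(g has_derivative blinfun_apply G) (at x)"
  shows "total_deriv g x = G"
  using frechet_derivative_at[OF assms, symmetric] by (simp add: total_deriv_def blinfun_apply_inverse)

lemma has_derivative_total_deriv: "g differentiable at x \<Longrightarrow> (g has_derivative blinfun_apply (total_deriv g x)) (at x)"
  unfolding total_deriv_def frechet_derivative_works
  by (subst bounded_linear_Blinfun_apply) (erule has_derivative_bounded_linear, assumption)

text \<open>The constants bound the function (\<open>A\<close>), its derivative (\<open>B\<close>) and the Lipschitz constant of the
derivative (\<open>D\<close>). That \<open>B\<close> is also a Lipschitz constant of the function has to be demanded
separately because \<open>U\<close> need not be convex; the product rule uses it.\<close>

definition C11_on :: "'a::real_normed_vector set \<Rightarrow> real \<Rightarrow> real \<Rightarrow> real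
    \<Rightarrow> ('a \<Rightarrow> 'b::real_normed_vector) \<Rightarrow> bool" where
  "C11_on U A B D g \<longleftrightarrow> open U \<and>
     (\<forall>x\<in>U. norm (g x) \<le> A \<and> g differentiable at x \<and> norm (total_deriv g x) \<le> B \<and>
        (\<forall>y\<in>U. norm (g y - g x) \<le> B * norm (y - x) \<and> norm (total_deriv g y - total_deriv g x) \<le> D * norm (y - x)))"

lemma C11_onI:
  assumes "open U"
    and "\<And>x. x \<in> U \<Longrightarrow> norm (g x) \<le> A"
    and der: "\<And>x. x \<in> U \<Longrightarrow> (g has_derivative blinfun_apply (g' x)) (at x)"
    and "\<And>x. x \<in> U \<Longrightarrow> norm (g' x) \<le> B"
    and "\<And>x y. x \<in> U \<Longrightarrow> y \<in> U \<Longrightarrow> norm (g y - g x) \<le> B * norm (y - x)"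
    and "\<And>x y. x \<in> U \<Longrightarrow> y \<in> U \<Longrightarrow> norm (g' y - g' x) \<le> D * norm (y - x)"
  shows "C11_on U A B D g"
  unfolding C11_on_def using assms total_deriv_eq[OF der] by (auto simp: differentiable_def)

lemma C11_onD:
  assumes "C11_on U A B D g" "x \<in> U"
  shows "norm (g x) \<le> A" "(g has_derivative blinfun_apply (total_deriv g x)) (at x)" "norm (total_deriv g x) \<le> B"
    "y \<in> U \<Longrightarrow> norm (g y - g x) \<le> B * norm (y - x)"
    "y \<in> U \<Longrightarrow> norm (total_deriv g y - total_deriv g x) \<le> D * norm (y - x)"
  using assms has_derivative_total_deriv unfolding C11_on_def by auto

lemma C11_on_open: "C11_on U A B D g \<Longrightarrow> open U"
  by (simp add: C11_on_def)

lemma C11_on_mono: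
  assumes g: "C11_on U A B D g" and "A \<le> A'" "B \<le> B'" "D \<le> D'"
  shows "C11_on U A' B' D' g"
proof (rule C11_onI[where g' = "total_deriv g"])
  fix x y assume x: "x \<in> U" "y \<in> U"
  show "norm (g y - g x) \<le> B' * norm (y - x)"
    using C11_onD(4)[OF g x] assms by (meson mult_right_mono norm_ge_zero order_trans)
  show "norm (total_deriv g y - total_deriv g x) \<le> D' * norm (y - x)"
    using C11_onD(5)[OF g x] assms by (meson mult_right_mono norm_ge_zero order_trans)
next
  fix x assume x: "x \<in> U"
  show "norm (g x) \<le> A'" "norm (total_deriv g x) \<le> B'" "(g has_derivative blinfun_apply (total_deriv g x)) (at x)"
    using C11_onD(1-3)[OF g x] assms(2,3) by auto
qed (rule C11_on_open[OF g])

lemma C11_on_subset: "C11_on U A B D g \<Longrightarrow> open W \<Longrightarrow> W \<subseteq> U \<Longrightarrow> C11_on W A B D g"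
  unfolding C11_on_def by blast

lemma C11_on_cong:
  assumes g: "C11_on U A B D g" and eq: "\<And>x. x \<in> U \<Longrightarrow> h x = g x"
  shows "C11_on U A B D h"
proof (rule C11_onI[where g' = "total_deriv g"])
  show U: "open U" using g by (simp add: C11_on_def)
  fix x assume x: "x \<in> U"
  show "(h has_derivative blinfun_apply (total_deriv g x)) (at x)"
    by (rule has_derivative_transform_within_open[OF C11_onD(2)[OF g x] U x]) (simp add: eq)
qed (use C11_onD[OF g] eq in auto)

lemma C11_on_zero: "open U \<Longrightarrow> 0 \<le> A \<Longrightarrow> 0 \<le> B \<Longrightarrow> 0 \<le> D \<Longrightarrow> C11_on U A B D (\<lambda>x. 0)"
  by (rule C11_onI[where g' = "\<lambda>_. 0"]) (auto simp: zero_blinfun.rep_eq)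

text \<open>The constants survive gluing because Lipschitz bounds on the whole space are local
(\<open>local_lipschitz_imp_global\<close>).\<close>

lemma C11_on_UNIV_if_local:
  fixes g :: "'a::real_normed_vector \<Rightarrow> 'b::real_normed_vector"
  assumes loc: "\<And>x. \<exists>U. x \<in> U \<and> C11_on U A B D g"
  shows "C11_on UNIV A B D g"
proof (rule C11_onI[where g' = "total_deriv g"])
  fix x y
  show "norm (g y - g x) \<le> B * norm (y - x)"
    by (rule local_lipschitz_imp_global) (meson loc C11_onD(4) C11_on_open)
  show "norm (total_deriv g y - total_deriv g x) \<le> D * norm (y - x)"
    by (rule local_lipschitz_imp_global) (meson loc C11_onD(5) C11_on_open)
  show "norm (g x) \<le> A" "norm (total_deriv g x) \<le> B" "(g has_derivative blinfun_apply (total_deriv g x)) (at x)"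
    using loc[of x] C11_onD by blast+
qed auto

text \<open>The product rule, quantitatively. The scalar factor is bounded by \<open>1\<close> because it will be a cutoff.\<close>

lemma C11_on_scaleR:
  fixes \<phi> :: "'a::real_normed_vector \<Rightarrow> real" and g :: "'a \<Rightarrow> 'b::real_normed_vector"
  assumes p: "C11_on U 1 b d \<phi>" and g: "C11_on U A B D g"
  shows "C11_on U A (b * A + B) (d * A + 2 * b * B + D) (\<lambda>x. \<phi> x *\<^sub>R g x)"
proof (rule C11_onI[where g' = "\<lambda>x. \<phi> x *\<^sub>R total_deriv g x + (blinfun_scaleR_left (g x) o\<^sub>L total_deriv \<phi> x)"])
  show "open U" using p by (simp add: C11_on_def)
  have sl: "norm (blinfun_scaleR_left v o\<^sub>L G) \<le> norm v * norm G"
    for v :: 'b and G :: "'a \<Rightarrow>\<^sub>L real"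
  proof (rule norm_blinfun_bound)
    fix x show "norm ((blinfun_scaleR_left v o\<^sub>L G) x) \<le> norm v * norm G * norm x"
      using mult_left_mono[OF norm_blinfun[of G x], of "norm v"] by (simp add: mult_ac)
  qed auto
  fix x assume x: "x \<in> U"
  note px = C11_onD[OF p x] and gx = C11_onD[OF g x]
  have nn: "0 \<le> A" "0 \<le> b" "0 \<le> B"
    using gx(1,3) px(3) norm_ge_zero order_trans by blast+
  have "norm (\<phi> x) * norm (g x) \<le> 1 * A"
    using px(1) gx(1) by (intro mult_mono) auto
  then show "norm (\<phi> x *\<^sub>R g x) \<le> A" by simp
  show "((\<lambda>x. \<phi> x *\<^sub>R g x) has_derivative blinfun_apply (\<phi> x *\<^sub>R total_deriv g x + (blinfun_scaleR_left (g x) o\<^sub>L total_deriv \<phi> x))) (at x)"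
    by (rule has_derivative_eq_rhs[OF has_derivative_scaleR[OF px(2) gx(2)]])
      (simp add: fun_eq_iff blinfun.add_left blinfun.scaleR_left)
  have "norm (\<phi> x *\<^sub>R total_deriv g x) \<le> 1 * B"
    unfolding norm_scaleR using px(1) gx(3) by (intro mult_mono) auto
  moreover have "norm (blinfun_scaleR_left (g x) o\<^sub>L total_deriv \<phi> x) \<le> A * b"
    by (rule order_trans[OF sl]) (use px(3) gx(1) nn in \<open>intro mult_mono, auto\<close>)
  ultimately show "norm (\<phi> x *\<^sub>R total_deriv g x + (blinfun_scaleR_left (g x) o\<^sub>L total_deriv \<phi> x)) \<le> b * A + B"
    by (intro order_trans[OF norm_triangle_ineq]) (simp add: mult.commute)
  fix y assume y: "y \<in> U"
  note py = C11_onD[OF p y] and gy = C11_onD[OF g y]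
  let ?t = "norm (y - x)"
  have 1: "norm (\<phi> y *\<^sub>R (g y - g x)) \<le> 1 * (B * ?t)"
    unfolding norm_scaleR using py(1) gx(4)[OF y] by (intro mult_mono) auto
  have 2: "norm ((\<phi> y - \<phi> x) *\<^sub>R g x) \<le> (b * ?t) * A"
    unfolding norm_scaleR using px(4)[OF y] gx(1) nn by (intro mult_mono) auto
  have "\<phi> y *\<^sub>R g y - \<phi> x *\<^sub>R g x = \<phi> y *\<^sub>R (g y - g x) + (\<phi> y - \<phi> x) *\<^sub>R g x"
    by (simp add: algebra_simps)
  then show "norm (\<phi> y *\<^sub>R g y - \<phi> x *\<^sub>R g x) \<le> (b * A + B) * ?t"
    using 1 2 norm_triangle_ineq[of "\<phi> y *\<^sub>R (g y - g x)" "(\<phi> y - \<phi> x) *\<^sub>R g x"]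
    by (simp add: algebra_simps)
  let ?p = "\<phi> y *\<^sub>R (total_deriv g y - total_deriv g x)" and ?q = "(\<phi> y - \<phi> x) *\<^sub>R total_deriv g x"
  let ?r = "blinfun_scaleR_left (g y - g x) o\<^sub>L total_deriv \<phi> y"
    and ?s = "blinfun_scaleR_left (g x) o\<^sub>L (total_deriv \<phi> y - total_deriv \<phi> x)"
  have a: "norm ?p \<le> 1 * (D * ?t)"
    unfolding norm_scaleR using py(1) gx(5)[OF y] by (intro mult_mono) auto
  have b: "norm ?q \<le> (b * ?t) * B"
    unfolding norm_scaleR using px(4)[OF y] gx(3) nn by (intro mult_mono) auto
  have c: "norm ?r \<le> (B * ?t) * b"
    by (rule order_trans[OF sl], rule mult_mono) (use gx(4)[OF y] py(3) nn in auto)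
  have d: "norm ?s \<le> A * (d * ?t)"
    by (rule order_trans[OF sl], rule mult_mono) (use px(5)[OF y] gx(1) nn in auto)
  have "(\<phi> y *\<^sub>R total_deriv g y + (blinfun_scaleR_left (g y) o\<^sub>L total_deriv \<phi> y)) - (\<phi> x *\<^sub>R total_deriv g x + (blinfun_scaleR_left (g x) o\<^sub>L total_deriv \<phi> x))
    = (?p + ?q) + (?r + ?s)"
    by (rule blinfun_eqI) (simp add: blinfun.bilinear_simps algebra_simps)
  moreover have "norm ((?p + ?q) + (?r + ?s)) \<le> (norm ?p + norm ?q) + (norm ?r + norm ?s)"
    by (meson add_mono norm_triangle_ineq order_trans)
  ultimately show "norm ((\<phi> y *\<^sub>R total_deriv g y + (blinfun_scaleR_left (g y) o\<^sub>L total_deriv \<phi> y)) - (\<phi> x *\<^sub>R total_deriv g x + (blinfun_scaleR_left (g x) o\<^sub>L total_deriv \<phi> x)))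
      \<le> (d * A + 2 * b * B + D) * ?t"
    using a b c d by (simp add: algebra_simps)
qed

text \<open>The bounds \<open>(1, \<beta>, \<beta>\<^sup>2)\<close> are those of a cutoff on the scale \<open>1/\<beta>\<close>. They reproduce themselves under
products with \<open>\<beta>\<close> adding up, as the mixed term of the product rule completes the square.\<close>

lemma C11_on_prod:
  fixes \<phi> :: "'i \<Rightarrow> 'a::real_normed_vector \<Rightarrow> real" and \<beta> :: real
  assumes "finite I" "open U" and \<phi>: "\<And>i. i \<in> I \<Longrightarrow> C11_on U 1 \<beta> (\<beta>\<^sup>2) (\<phi> i)"
  shows "C11_on U 1 (card I * \<beta>) ((card I * \<beta>)\<^sup>2) (\<lambda>x. \<Prod>i\<in>I. \<phi> i x)"
  using assms(1) \<phi>
proof (induction I)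
  case empty
  show ?case
    using \<open>open U\<close> by (intro C11_onI[where g' = "\<lambda>_. 0"]) (auto simp: zero_blinfun.rep_eq)
next
  case (insert i I)
  have "C11_on U 1 (\<beta> * 1 + card I * \<beta>) (\<beta>\<^sup>2 * 1 + 2 * \<beta> * (card I * \<beta>) + (card I * \<beta>)\<^sup>2)
      (\<lambda>x. \<phi> i x *\<^sub>R (\<Prod>i\<in>I. \<phi> i x))"
    by (rule C11_on_scaleR) (use insert in auto)
  moreover have "\<beta> * 1 + card I * \<beta> = card (insert i I) * \<beta>"
    "\<beta>\<^sup>2 * 1 + 2 * \<beta> * (card I * \<beta>) + (card I * \<beta>)\<^sup>2 = (card (insert i I) * \<beta>)\<^sup>2"
    using insert.hyps by (auto simp: power2_eq_square algebra_simps)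
  ultimately show ?case
    using insert.hyps by simp
qed

text \<open>The \<open>C\<^sup>1\<close> step from \<open>0\<close> to \<open>1\<close> on the unit interval whose derivative is a hat function. A corner of
the derivative is harmless since only its Lipschitz constant matters.\<close>

definition smooth_step :: "real \<Rightarrow> real" where
  "smooth_step u = 2 * (max 0 u)\<^sup>2 - 4 * (max 0 (u - 1/2))\<^sup>2 + 2 * (max 0 (u - 1))\<^sup>2"

definition smooth_step_deriv :: "real \<Rightarrow> real" where
  "smooth_step_deriv u = 4 * max 0 u - 8 * max 0 (u - 1/2) + 4 * max 0 (u - 1)"

lemma smooth_step_le_0: "u \<le> 0 \<Longrightarrow> smooth_step u = 0"
  by (simp add: smooth_step_def)

lemma smooth_step_ge_1: "u \<ge> 1 \<Longrightarrow> smooth_step u = 1"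
  by (simp add: smooth_step_def power2_eq_square algebra_simps)

lemma smooth_step_bound: "\<bar>smooth_step u\<bar> \<le> 1"
proof -
  consider "u \<le> 0" | "0 \<le> u" "u \<le> 1/2" | "1/2 \<le> u" "u \<le> 1" | "u \<ge> 1" by linarith
  then show ?thesis
  proof cases
    case 2
    then have "u\<^sup>2 \<le> (1/2)\<^sup>2" by (intro power_mono) auto
    then show ?thesis using 2 by (simp add: smooth_step_def power2_eq_square)
  next
    case 3
    then have "(1 - u)\<^sup>2 \<le> (1/2)\<^sup>2" by (intro power_mono) auto
    moreover have "smooth_step u = 1 - 2 * (1 - u)\<^sup>2"
      using 3 by (simp add: smooth_step_def power2_eq_square algebra_simps)
    moreover have "0 \<le> (1 - u)\<^sup>2" by simp
    ultimately show ?thesis by (simp add: power2_eq_square)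
  qed (auto simp: smooth_step_le_0 smooth_step_ge_1)
qed

lemma smooth_step_deriv_bound: "\<bar>smooth_step_deriv u\<bar> \<le> 2"
  unfolding smooth_step_deriv_def max_def by auto

lemma smooth_step_deriv_lipschitz: "\<bar>smooth_step_deriv u - smooth_step_deriv v\<bar> \<le> 16 * \<bar>u - v\<bar>"
proof -
  have *: "\<bar>max 0 (u - a) - max 0 (v - a)\<bar> \<le> \<bar>u - v\<bar>" for a
    by (simp add: max_def)
  have lin: "\<bar>4 * a - 8 * b + 4 * c - (4 * a' - 8 * b' + 4 * c')\<bar> \<le> 16 * t"
    if "\<bar>a - a'\<bar> \<le> t" "\<bar>b - b'\<bar> \<le> t" "\<bar>c - c'\<bar> \<le> t" for a a' b b' c c' t :: real
    using that unfolding abs_le_iff by (intro conjI) linarith+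
  show ?thesis
    unfolding smooth_step_deriv_def by (rule lin) (use *[of 0] *[of "1/2"] *[of 1] in auto)
qed

lemma DERIV_max_0_squared: "((\<lambda>u::real. (max 0 u)\<^sup>2) has_real_derivative 2 * max 0 u) (at u)"
proof -
  consider "u > 0" | "u < 0" | "u = 0" by linarith
  then show ?thesis
  proof cases
    case 1
    have "((\<lambda>u::real. u\<^sup>2) has_real_derivative 2 * max 0 u) (at u)"
      using 1 by (auto intro!: derivative_eq_intros)
    then show ?thesis
      by (rule has_field_derivative_transform_within_open[where S = "{0<..}"]) (use 1 in auto)
  next
    case 2
    have "((\<lambda>u::real. 0) has_real_derivative 2 * max 0 u) (at u)"
      using 2 by (auto intro!: derivative_eq_intros)
    then show ?thesis
      by (rule has_field_derivative_transform_within_open[where S = "{..<0}"]) (use 2 in auto)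
  next
    case 3
    have "((\<lambda>h::real. (max 0 h)\<^sup>2 / h) \<longlongrightarrow> 0) (at 0)"
    proof (rule tendsto_0_le[where K = 1 and f = "\<lambda>h. h"])
      show "\<forall>\<^sub>F h in at (0::real). norm ((max 0 h)\<^sup>2 / h) \<le> norm h * (1::real)"
        by (rule always_eventually) (simp add: max_def power2_eq_square)
    qed (rule tendsto_ident_at)
    then show ?thesis
      using 3 by (simp add: DERIV_def)
  qed
qed

lemma DERIV_smooth_step: "(smooth_step has_real_derivative smooth_step_deriv u) (at u)"
proof -
  have D: "((\<lambda>u. (max 0 (u - a))\<^sup>2) has_real_derivative 2 * max 0 (u - a)) (at u)" for a :: real
  proof -
    have "((\<lambda>u. u - a) has_real_derivative 1) (at u)"
      by (auto intro!: derivative_eq_intros)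
    from DERIV_chain2[OF DERIV_max_0_squared this] show ?thesis by simp
  qed
  show ?thesis
    unfolding smooth_step_def[abs_def] smooth_step_deriv_def
    by (rule derivative_eq_intros D D[of 0, simplified] refl)+ simp
qed

lemma smooth_step_lipschitz: "\<bar>smooth_step u - smooth_step v\<bar> \<le> 2 * \<bar>u - v\<bar>"
proof -
  have "norm (smooth_step u - smooth_step v) \<le> 2 * norm (u - v)"
    by (rule field_differentiable_bound[OF convex_UNIV DERIV_smooth_step])
      (simp_all add: smooth_step_deriv_bound)
  then show ?thesis by simp
qed

text \<open>The constant \<open>4\<close> is chosen so that the bound on the second-order term is the square of the one on
the first-order term, as \<open>C11_on_prod\<close> needs it.\<close>

lemma C11_on_smooth_step_linear:
  fixes b :: "'a::euclidean_space"
  assumes "b \<in> Basis" "w > 0" "\<bar>s\<bar> = 1"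
  shows "C11_on UNIV 1 (4 / w) ((4 / w)\<^sup>2) (\<lambda>x. smooth_step ((m + s * (x \<bullet> b - c)) / w))"
proof (rule C11_onI[where g' = "\<lambda>x. (smooth_step_deriv ((m + s * (x \<bullet> b - c)) / w) * (s / w)) *\<^sub>R blinfun_inner_left b"])
  have nb: "norm (blinfun_inner_left b :: 'a \<Rightarrow>\<^sub>L real) \<le> 1"
    by (rule norm_blinfun_bound) (use assms Basis_le_norm in auto)
  have s: "\<bar>s / w\<bar> = 1 / w" and w: "w \<noteq> 0" using assms by simp_all
  fix x y :: 'a
  let ?u = "\<lambda>x. (m + s * (x \<bullet> b - c)) / w"
  have u: "\<bar>?u y - ?u x\<bar> \<le> norm (y - x) / w"
  proof -
    have "?u y - ?u x = (s / w) * ((y - x) \<bullet> b)"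
      using w by (simp add: inner_diff_left field_simps)
    note this[THEN arg_cong[where f = abs]]
    then have "\<bar>?u y - ?u x\<bar> = (1 / w) * \<bar>(y - x) \<bullet> b\<bar>"
      by (simp only: abs_mult s)
    also have "\<dots> \<le> (1 / w) * norm (y - x)"
      using assms Basis_le_norm by (intro mult_left_mono) auto
    finally show ?thesis by simp
  qed
  show "norm (smooth_step (?u x)) \<le> 1"
    using smooth_step_bound by simp
  have "((\<lambda>x. (s / w) * (x \<bullet> b) + (m - s * c) / w) has_derivative (\<lambda>h. (s / w) * (h \<bullet> b))) (at x)"
    by (intro has_derivative_add_const has_derivative_mult_right has_derivative_inner_left has_derivative_ident)
  moreover have "(\<lambda>x. (s / w) * (x \<bullet> b) + (m - s * c) / w) = ?u"
    using w by (simp add: fun_eq_iff field_simps)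
  ultimately have "(?u has_derivative (\<lambda>h. (s / w) * (h \<bullet> b))) (at x)"
    by simp
  from DERIV_compose_FDERIV[OF DERIV_smooth_step this]
  have "((\<lambda>x. smooth_step (?u x)) has_derivative
      (\<lambda>h. (s / w) * (h \<bullet> b) * smooth_step_deriv (?u x))) (at x)" .
  then show "((\<lambda>x. smooth_step (?u x)) has_derivative
      blinfun_apply ((smooth_step_deriv (?u x) * (s / w)) *\<^sub>R blinfun_inner_left b)) (at x)"
    by (rule has_derivative_eq_rhs) (simp add: fun_eq_iff blinfun.scaleR_left)
  have "norm ((smooth_step_deriv (?u x) * (s / w)) *\<^sub>R blinfun_inner_left b) \<le> (2 * (1 / w)) * 1"
    unfolding norm_scaleR abs_mult s
    using smooth_step_deriv_bound nb assms by (intro mult_mono) auto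
  then show "norm ((smooth_step_deriv (?u x) * (s / w)) *\<^sub>R blinfun_inner_left b) \<le> 4 / w"
    using assms by (simp add: field_simps)
  show "norm (smooth_step (?u y) - smooth_step (?u x)) \<le> 4 / w * norm (y - x)"
  proof -
    have "norm (smooth_step (?u y) - smooth_step (?u x)) \<le> 2 * (norm (y - x) / w)"
      using smooth_step_lipschitz[of "?u y" "?u x"] u by simp
    also have "\<dots> \<le> 4 / w * norm (y - x)"
      using assms by (simp add: field_simps)
    finally show ?thesis .
  qed
  have "norm ((smooth_step_deriv (?u y) - smooth_step_deriv (?u x)) * (s / w))
      \<le> (16 * (norm (y - x) / w)) * (1 / w)"
    unfolding real_norm_def abs_mult s
    using smooth_step_deriv_lipschitz[of "?u y" "?u x"] u assms by (intro mult_mono) auto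
  then have "norm (((smooth_step_deriv (?u y) - smooth_step_deriv (?u x)) * (s / w)) *\<^sub>R
      (blinfun_inner_left b :: 'a \<Rightarrow>\<^sub>L real)) \<le> ((16 * (norm (y - x) / w)) * (1 / w)) * 1"
    unfolding norm_scaleR using nb by (intro mult_mono) (use assms in auto)
  then show "norm ((smooth_step_deriv (?u y) * (s / w)) *\<^sub>R (blinfun_inner_left b :: 'a \<Rightarrow>\<^sub>L real)
      - (smooth_step_deriv (?u x) * (s / w)) *\<^sub>R blinfun_inner_left b) \<le> (4 / w)\<^sup>2 * norm (y - x)"
    unfolding scaleR_diff_left[symmetric] left_diff_distrib[symmetric]
    by (simp add: power2_eq_square)
qed auto

section \<open>Hoelder regularity of series\<close>

lemma summable_poly4_geometric:
  fixes r :: real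
  assumes "0 < r" "r < 1"
  shows "summable (\<lambda>n. (real n + 3) ^ 4 * r ^ n)"
proof -
  \<comment> \<open>Any ratio strictly between \<open>r\<close> and \<open>1\<close> bounds the quotients of the terms eventually.\<close>
  define c where "c = (1 + r) / 2"
  have c: "r < c" "c < 1" "0 < c" using assms by (auto simp: c_def)
  have "(\<lambda>n. 1 / (3 + real n)) \<longlonglongrightarrow> 0"
    by (rule real_tendsto_divide_at_top[OF tendsto_const
          filterlim_tendsto_add_at_top[OF tendsto_const filterlim_real_sequentially]])
  then have "(\<lambda>n. (1 + 1 / (3 + real n)) ^ 4 * r) \<longlonglongrightarrow> (1 + 0) ^ 4 * r"
    by (intro tendsto_intros)
  then have "\<forall>\<^sub>F n in sequentially. (1 + 1 / (3 + real n)) ^ 4 * r < c"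
    using c by (intro order_tendstoD) simp_all
  then obtain N where N: "\<And>n. n \<ge> N \<Longrightarrow> (1 + 1 / (3 + real n)) ^ 4 * r < c"
    by (auto simp: eventually_sequentially)
  show ?thesis
  proof (rule summable_ratio_test[OF c(2)])
    fix n assume n: "N \<le> n"
    have "real (Suc n) + 3 = (1 + 1 / (3 + real n)) * (real n + 3)"
      by (simp add: field_simps)
    then have "(real (Suc n) + 3) ^ 4 * r ^ Suc n = ((1 + 1 / (3 + real n)) * (real n + 3)) ^ 4 * (r * r ^ n)"
      by (simp only: power_Suc)
    also have "\<dots> = (1 + 1 / (3 + real n)) ^ 4 * r * ((real n + 3) ^ 4 * r ^ n)"
      by (simp only: power_mult_distrib mult_ac)
    also have "\<dots> \<le> c * ((real n + 3) ^ 4 * r ^ n)"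
      using N[OF n] assms by (intro mult_right_mono) auto
    finally show "norm ((real (Suc n) + 3) ^ 4 * r ^ Suc n) \<le> c * norm ((real n + 3) ^ 4 * r ^ n)"
      using assms by (simp del: power_Suc)
  qed
qed

text \<open>The increment of a derivative of size \<open>p\<close> over a distance \<open>t\<close> is bounded both by \<open>2 * p\<close> and, if the
derivative has Lipschitz constant \<open>1\<close>, by \<open>t\<close>; a weighted geometric mean of the two gives the Hoelder bound.\<close>

lemma min_le_powr_interpolation:
  fixes p t \<alpha> :: real
  assumes "0 < \<alpha>" "\<alpha> < 1" "0 < p" "0 \<le> t"
  shows "min (2 * p) t \<le> 2 * (p powr (1 - \<alpha>) * t powr \<alpha>)"
proof (cases "t \<le> p")
  case True
  have "t = t powr (1 - \<alpha>) * t powr \<alpha>"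
    using assms by (cases "t = 0") (auto simp flip: powr_add)
  also have "\<dots> \<le> p powr (1 - \<alpha>) * t powr \<alpha>"
    using True assms by (intro mult_right_mono powr_mono2) auto
  finally show ?thesis
    using assms powr_ge_zero[of p "1 - \<alpha>"] powr_ge_zero[of t \<alpha>] by (simp add: min_def)
next
  case False
  have "p = p powr (1 - \<alpha>) * p powr \<alpha>"
    using assms by (simp flip: powr_add)
  also have "\<dots> \<le> p powr (1 - \<alpha>) * t powr \<alpha>"
    using False assms by (intro mult_left_mono powr_mono2) auto
  finally show ?thesis by (simp add: min_def)
qed

text \<open>The geometric factor present in the bound for the derivative and absent from the one for its
Lipschitz constant leaves, after interpolation, the factor \<open>(1/2)\<^sup>n\<^sup>(\<^sup>1\<^sup>-\<^sup>\<alpha>\<^sup>)\<close>. Hence it suffices that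
\<open>E\<close> grows subexponentially.\<close>

lemma C11_series_holder:
  fixes g :: "nat \<Rightarrow> 'a::real_normed_vector \<Rightarrow> 'b::banach"
  assumes g: "\<And>n. C11_on UNIV (K * (1/2) ^ n) (E n * (1/2) ^ n) (E n) (g n)"
    and E: "\<And>r. 0 < r \<Longrightarrow> r < 1 \<Longrightarrow> summable (\<lambda>n. E n * r ^ n)"
  shows "\<And>x. summable (\<lambda>n. g n x)" (is "\<And>x. ?s x")
    and "\<And>x. summable (\<lambda>n. total_deriv (g n) x)" (is "\<And>x. ?s' x")
    and "((\<lambda>x. \<Sum>n. g n x) has_derivative blinfun_apply (\<Sum>n. total_deriv (g n) x)) (at x)" (is ?d)
    and "0 < \<alpha> \<Longrightarrow> \<alpha> < 1 \<Longrightarrow>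
      \<exists>C. \<forall>x y. norm ((\<Sum>n. total_deriv (g n) x) - (\<Sum>n. total_deriv (g n) y)) \<le> C * dist x y powr \<alpha>"
proof -
  note gD = C11_onD[OF g UNIV_I]
  show s: "?s x" for x
    by (rule summable_comparison_test'[where g = "\<lambda>n. K * (1/2) ^ n"])
      (auto intro!: summable_mult summable_geometric gD(1))
  have sE: "summable (\<lambda>n. E n * (1/2) ^ n)"
    by (rule E) auto
  show s': "?s' x" for x
    by (rule summable_comparison_test'[OF sE]) (rule gD(3))
  have E_nonneg: "0 \<le> E n" for n
  proof -
    have "0 * (1/2) ^ n \<le> E n * (1/2) ^ n"
      using order_trans[OF norm_ge_zero gD(3)[of n 0]] by simp
    then show ?thesis
      by (rule mult_right_le_imp_le) simp
  qed
  show ?d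
  proof -
    have "\<exists>G. \<forall>x\<in>UNIV. (\<lambda>n. g n x) sums (G x) \<and> (G has_derivative blinfun_apply (\<Sum>n. total_deriv (g n) x)) (at x within UNIV)"
    proof (rule has_derivative_series[OF convex_UNIV])
      show "(g n has_derivative blinfun_apply (total_deriv (g n) x)) (at x within UNIV)" for n x
        using gD(2) by blast
      show "(\<lambda>n. g n 0) sums (\<Sum>n. g n 0)"
        using s by (rule summable_sums)
      fix e :: real assume e: "e > 0"
      have "(\<lambda>k. \<Sum>n. E (n + k) * (1/2) ^ (n + k)) \<longlonglongrightarrow> 0"
        by (rule suminf_exist_split2[OF sE])
      then have "\<forall>\<^sub>F k in sequentially. (\<Sum>n. E (n + k) * (1/2) ^ (n + k)) < e"
        using e by (rule order_tendstoD)
      then show "\<forall>\<^sub>F k in sequentially. \<forall>x\<in>UNIV. \<forall>h. norm ((\<Sum>n<k. blinfun_apply (total_deriv (g n) x) h)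
          - blinfun_apply (\<Sum>n. total_deriv (g n) x) h) \<le> e * norm h"
      proof (eventually_elim, intro ballI allI)
        fix k x h assume k: "(\<Sum>n. E (n + k) * (1/2) ^ (n + k)) < e"
        have "(\<Sum>n. total_deriv (g n) x) = (\<Sum>n. total_deriv (g (n + k)) x) + (\<Sum>n<k. total_deriv (g n) x)"
          by (rule suminf_split_initial_segment[OF s'])
        then have "norm ((\<Sum>n<k. total_deriv (g n) x) - (\<Sum>n. total_deriv (g n) x)) = norm (\<Sum>n. total_deriv (g (n + k)) x)"
          by simp
        also have "\<dots> \<le> (\<Sum>n. E (n + k) * (1/2) ^ (n + k))"
          by (rule norm_suminf_le[OF gD(3)]) (rule summable_ignore_initial_segment[OF sE])
        finally have "norm ((\<Sum>n<k. total_deriv (g n) x) - (\<Sum>n. total_deriv (g n) x)) \<le> e"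
          using k by simp
        then have "norm (blinfun_apply ((\<Sum>n<k. total_deriv (g n) x) - (\<Sum>n. total_deriv (g n) x)) h) \<le> e * norm h"
          by (meson norm_blinfun order_trans mult_right_mono norm_ge_zero)
        then show "norm ((\<Sum>n<k. blinfun_apply (total_deriv (g n) x) h) - blinfun_apply (\<Sum>n. total_deriv (g n) x) h) \<le> e * norm h"
          by (simp add: blinfun.diff_left blinfun.sum_left)
      qed
    qed (rule UNIV_I)
    then obtain G where G: "\<And>x. (\<lambda>n. g n x) sums (G x)"
      "\<And>x. (G has_derivative blinfun_apply (\<Sum>n. total_deriv (g n) x)) (at x)"
      by auto
    then have "G = (\<lambda>x. \<Sum>n. g n x)"
      by (auto simp: sums_iff)
    with G(2) show ?thesis by simp
  qed
  show "\<exists>C. \<forall>x y. norm ((\<Sum>n. total_deriv (g n) x) - (\<Sum>n. total_deriv (g n) y)) \<le> C * dist x y powr \<alpha>"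
    if \<alpha>: "0 < \<alpha>" "\<alpha> < 1"
  proof -
    define r :: real where "r = (1/2) powr (1 - \<alpha>)"
    have r: "0 < r" "r < 1"
      using \<alpha> powr_less_mono'[of "1/2" 0 "1 - \<alpha>"] by (auto simp: r_def powr_less_one)
    have rn: "((1/2) ^ n) powr (1 - \<alpha>) = r ^ n" for n
      by (simp add: r_def powr_powr mult.commute flip: powr_realpow)
    have sr: "summable (\<lambda>n. E n * r ^ n)"
      using r by (rule E)
    have "norm ((\<Sum>n. total_deriv (g n) x) - (\<Sum>n. total_deriv (g n) y)) \<le> (2 * (\<Sum>n. E n * r ^ n)) * dist x y powr \<alpha>" for x y
    proof -
      have "norm (total_deriv (g n) x - total_deriv (g n) y) \<le> (E n * r ^ n) * (2 * dist x y powr \<alpha>)" for n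
      proof -
        have "norm (total_deriv (g n) x - total_deriv (g n) y) \<le> E n * (2 * (1/2) ^ n)"
          using gD(3)[of n x] gD(3)[of n y] norm_triangle_ineq4[of "total_deriv (g n) x" "total_deriv (g n) y"] by simp
        moreover have "norm (total_deriv (g n) x - total_deriv (g n) y) \<le> E n * dist x y"
          using gD(5)[OF UNIV_I] by (simp add: dist_norm)
        ultimately have "norm (total_deriv (g n) x - total_deriv (g n) y) \<le> E n * min (2 * (1/2) ^ n) (dist x y)"
          by (auto simp: min_def)
        also have "\<dots> \<le> E n * (2 * (((1/2) ^ n) powr (1 - \<alpha>) * dist x y powr \<alpha>))"
          using \<alpha> by (intro mult_left_mono min_le_powr_interpolation E_nonneg) auto
        also have "\<dots> = (E n * r ^ n) * (2 * dist x y powr \<alpha>)"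
          unfolding rn by simp
        finally show ?thesis .
      qed
      then have "norm (\<Sum>n. total_deriv (g n) x - total_deriv (g n) y) \<le> (\<Sum>n. (E n * r ^ n) * (2 * dist x y powr \<alpha>))"
        by (rule norm_suminf_le) (rule summable_mult2[OF sr])
      then show ?thesis
        using suminf_diff[OF s' s', of x y] suminf_mult2[OF sr, of "2 * dist x y powr \<alpha>"]
        by (simp add: mult_ac)
    qed
    then show ?thesis by blast
  qed
qed

section \<open>A fat Cantor set\<close>

locale fat_cantor =
  fixes \<rho> :: real
  assumes \<rho>_pos: "\<rho> > 0"
begin

text \<open>Half the length of an interval of level \<open>n\<close>. The last factor decreases, which leaves a gap of
relative length of order \<open>1/n\<^sup>2\<close> around the two intervals of the next level, but it stays above \<open>1\<close>,
so that the total length of the \<open>2\<^sup>n\<close> intervals does not shrink to \<open>0\<close>.\<close>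

definition q :: "nat \<Rightarrow> real" where
  "q n = \<rho> * (1/2) ^ n * (1 + 1 / (real n + 1))"

lemma q_pos: "q n > 0"
  using \<rho>_pos by (simp add: q_def add_pos_nonneg)

lemma q_le: "q n \<le> 2 * \<rho> * (1/2) ^ n"
  using \<rho>_pos by (simp add: q_def divide_simps)

lemma q_ge: "\<rho> * (1/2) ^ n \<le> q n"
  using \<rho>_pos by (simp add: q_def)

lemma q_gap: "q n - 2 * q (Suc n) = \<rho> * (1/2) ^ n / ((real n + 1) * (real n + 2))"
  unfolding q_def by (simp add: divide_simps) (simp add: algebra_simps)

lemma q_gap_pos: "2 * q (Suc n) < q n"
  using q_gap[of n] \<rho>_pos
  by (smt (verit) divide_pos_pos mult_pos_pos of_nat_0_le_iff zero_less_power half_gt_zero_iff)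

text \<open>The centre of the interval of level \<open>n\<close> to which \<open>t\<close> belongs, or to which \<open>t\<close> is assigned if it lies
in a gap: the sign of the displacement from the previous centre decides between the two halves.\<close>

primrec centre :: "nat \<Rightarrow> real \<Rightarrow> real" where
  "centre 0 t = 0"
| "centre (Suc n) t = centre n t + (if centre n t \<le> t then q (Suc n) else - q (Suc n))"

text \<open>The distance to the centre folds at each level. In particular it is continuous, although the
centre itself jumps.\<close>

lemma centre_dist_Suc: "\<bar>t - centre (Suc n) t\<bar> = \<bar>\<bar>t - centre n t\<bar> - q (Suc n)\<bar>"
  by (cases "centre n t \<le> t") auto

lemma continuous_centre_dist: "continuous_on UNIV (\<lambda>t. \<bar>t - centre n t\<bar>)"
proof (induction n)
  case 0
  show ?case by (simp add: continuous_intros)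
next
  case (Suc n)
  show ?case
    unfolding centre_dist_Suc by (intro continuous_intros Suc)
qed

text \<open>The signs that lead to a centre are constant on the open interval around it, because that interval
is on one side of each earlier centre.\<close>

lemma centre_cell:
  assumes "\<bar>t - centre n t\<bar> < q n" "\<bar>u - centre n t\<bar> < q n" "i \<le> n"
  shows "centre i u = centre i t"
  using assms
proof (induction n arbitrary: i)
  case (Suc n)
  have t: "\<bar>t - centre n t\<bar> < q n" and u: "\<bar>u - centre n t\<bar> < q n"
    using Suc.prems q_gap_pos[of n] by (auto split: if_splits)
  have IH: "centre i u = centre i t" if "i \<le> n" for i
    using Suc.IH[OF t u that] .
  show ?case
  proof (cases "i = Suc n")
    case True
    then show ?thesis
      using Suc.prems(1,2) by (auto simp: IH split: if_splits)
  qed (use IH Suc.prems in auto)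
qed simp

declare centre.simps(2)[simp del]

text \<open>By the folding rule, a band of distances at level \<open>n + 1\<close> comes from two bands of the same width at
level \<open>n\<close>. With strict inequalities these two are disjoint even if \<open>a = 0\<close>.\<close>

lemma emeasure_centre_dist:
  assumes "0 \<le> a" "a \<le> b" "b \<le> q n"
  shows "emeasure lborel {t. a < \<bar>t - centre n t\<bar> \<and> \<bar>t - centre n t\<bar> < b} = ennreal (2 ^ (n + 1) * (b - a))"
  using assms
proof (induction n arbitrary: a b)
  case 0
  have "{t. a < \<bar>t\<bar> \<and> \<bar>t\<bar> < b} = {a<..<b} \<union> {-b<..<-a}"
    using 0 by auto
  moreover have "emeasure lborel ({a<..<b} \<union> {-b<..<-a}) = emeasure lborel {a<..<b} + emeasure lborel {-b<..<-a}"
    using 0 by (intro plus_emeasure[symmetric]) auto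
  ultimately show ?case
    using 0 by (simp add: ennreal_plus[symmetric] del: ennreal_plus)
next
  case (Suc n)
  \<comment> \<open>The two halves of the folded band; here \<open>h\<close> stands for the distance at level \<open>n\<close>.\<close>
  have band: "a < \<bar>h - c\<bar> \<and> \<bar>h - c\<bar> < b \<longleftrightarrow> (c + a < h \<and> h < c + b) \<or> (c - b < h \<and> h < c - a)"
    if "0 \<le> a" for a b c h :: real
    using that by (cases "h \<le> c") auto
  let ?h = "\<lambda>t. \<bar>t - centre n t\<bar>" and ?q = "q (Suc n)"
  have [measurable]: "?h \<in> borel_measurable borel"
    by (rule borel_measurable_continuous_onI[OF continuous_centre_dist])
  have *: "{t. a < \<bar>t - centre (Suc n) t\<bar> \<and> \<bar>t - centre (Suc n) t\<bar> < b}
      = {t. ?q + a < ?h t \<and> ?h t < ?q + b} \<union> {t. ?q - b < ?h t \<and> ?h t < ?q - a}"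
    unfolding centre_dist_Suc using Suc.prems by (intro set_eqI) (simp only: band mem_Collect_eq Un_iff)
  have "emeasure lborel {t. a < \<bar>t - centre (Suc n) t\<bar> \<and> \<bar>t - centre (Suc n) t\<bar> < b}
      = emeasure lborel {t. ?q + a < ?h t \<and> ?h t < ?q + b}
      + emeasure lborel {t. ?q - b < ?h t \<and> ?h t < ?q - a}"
  unfolding * proof (rule plus_emeasure[symmetric])
    show "{t. ?q + a < ?h t \<and> ?h t < ?q + b} \<inter> {t. ?q - b < ?h t \<and> ?h t < ?q - a} = {}"
      using Suc.prems by (intro equals0I) (simp only: mem_Collect_eq Int_iff, linarith)
  qed measurable
  also have "\<dots> = ennreal (2 ^ (n + 1) * (b - a)) + ennreal (2 ^ (n + 1) * (b - a))"
  proof -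
    have le: "0 \<le> ?q + a" "?q + a \<le> ?q + b" "?q + b \<le> q n" "0 \<le> ?q - b" "?q - b \<le> ?q - a" "?q - a \<le> q n"
      using Suc.prems q_gap_pos[of n] by linarith+
    show ?thesis
      unfolding Suc.IH[OF le(1-3)] Suc.IH[OF le(4-6)] by simp
  qed
  also have "\<dots> = ennreal (2 ^ (Suc n + 1) * (b - a))"
    using Suc.prems by (simp add: ennreal_plus[symmetric] del: ennreal_plus)
  finally show ?case .
qed

definition cantor_set :: "real set" where
  "cantor_set = {t. \<forall>n. \<bar>t - centre n t\<bar> \<le> q n}"

lemma closed_cantor_level: "closed {t. \<bar>t - centre n t\<bar> \<le> q n}"
  using continuous_closed_vimage[OF closed_atMost, of "\<lambda>t. \<bar>t - centre n t\<bar>" "q n"]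
    continuous_centre_dist[of n]
  by (simp add: vimage_def continuous_on_eq_continuous_at)

text \<open>A point that is within reach of level \<open>n + 1\<close> cannot be in the gap of level \<open>n\<close>.\<close>

lemma cantor_setD:
  assumes "t \<in> cantor_set"
  shows "\<bar>t - centre n t\<bar> \<le> 2 * q (Suc n)"
  using assms centre_dist_Suc[of t n] unfolding cantor_set_def by (smt (verit) mem_Collect_eq)

lemma closed_cantor_set: "closed cantor_set"
proof -
  have "cantor_set = (\<Inter>n. {t. \<bar>t - centre n t\<bar> \<le> q n})"
    by (auto simp: cantor_set_def)
  then show ?thesis
    by (simp add: closed_INT closed_cantor_level)
qed

lemma emeasure_cantor_set: "emeasure lborel cantor_set \<ge> ennreal (2 * \<rho>)"
proof -
  let ?C = "\<lambda>n. {t. \<bar>t - centre n t\<bar> \<le> q n}"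
  have *: "cantor_set = (\<Inter>n. ?C n)"
    by (auto simp: cantor_set_def)
  have "ennreal (2 * \<rho>) \<le> (INF n. emeasure lborel (?C n))"
  proof (rule INF_greatest)
    fix n
    have "2 * \<rho> = 2 ^ (n + 1) * (\<rho> * (1/2) ^ n)"
      by (simp add: power_one_over)
    also have "\<dots> \<le> 2 ^ (n + 1) * (q n - 0)"
      using q_ge[of n] by (intro mult_left_mono) auto
    finally have "ennreal (2 * \<rho>) \<le> emeasure lborel {t. 0 < \<bar>t - centre n t\<bar> \<and> \<bar>t - centre n t\<bar> < q n}"
      using q_pos[of n] by (subst emeasure_centre_dist) (auto intro!: ennreal_leI)
    also have "\<dots> \<le> emeasure lborel (?C n)"
      using closed_cantor_level[of n] by (intro emeasure_mono) auto
    finally show "ennreal (2 * \<rho>) \<le> emeasure lborel (?C n)" .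
  qed
  also have "\<dots> = emeasure lborel cantor_set"
    unfolding *
  proof (rule INF_emeasure_decseq)
    show "range ?C \<subseteq> sets lborel"
      unfolding sets_lborel by (rule image_subsetI, rule borel_closed, rule closed_cantor_level)
    show dec: "decseq ?C"
    proof (rule decseq_SucI, rule subsetI)
      fix n t assume "t \<in> ?C (Suc n)"
      then show "t \<in> ?C n"
        using centre_dist_Suc[of t n] q_gap_pos[of n] unfolding mem_Collect_eq by linarith
    qed
    fix n
    have "?C n \<subseteq> ?C 0"
      using dec by (rule decseqD) simp
    also have "?C 0 \<subseteq> cbox (- q 0) (q 0)"
      by (auto simp: cbox_interval)
    finally have "emeasure lborel (?C n) \<le> emeasure lborel (cbox (- q 0) (q 0))"
      by (intro emeasure_mono) auto
    then show "emeasure lborel (?C n) \<noteq> \<infinity>"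
      using emeasure_lborel_cbox_finite[of "- q 0" "q 0"] by (auto simp: top_unique)
  qed
  finally show ?thesis .
qed

lemma q_tendsto_0: "q \<longlonglongrightarrow> 0"
proof (rule tendsto_sandwich[where f = "\<lambda>_. 0" and h = "\<lambda>n. 2 * \<rho> * (1/2) ^ n"])
  show "(\<lambda>n. 2 * \<rho> * (1/2) ^ n) \<longlonglongrightarrow> 0"
    by (intro tendsto_mult_right_zero LIMSEQ_power_zero) simp
  show "\<forall>\<^sub>F n in sequentially. 0 \<le> q n"
    by (rule always_eventually) (blast intro: less_imp_le q_pos)
  show "\<forall>\<^sub>F n in sequentially. q n \<le> 2 * \<rho> * (1/2) ^ n"
    by (rule always_eventually) (blast intro: q_le)
qed (rule tendsto_const)

lemma centre_tendsto:
  assumes "t \<in> cantor_set"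
  shows "(\<lambda>n. centre n t) \<longlonglongrightarrow> t"
proof -
  have "norm (centre n t - t) \<le> q n" for n
    using assms unfolding cantor_set_def by (simp add: abs_minus_commute)
  then have "(\<lambda>n. centre n t - t) \<longlonglongrightarrow> 0"
    by (intro Lim_null_comparison[OF _ q_tendsto_0] always_eventually allI)
  then show ?thesis
    by (rule LIM_zero_cancel)
qed

end

section \<open>Coordinate projections\<close>

definition coord_proj :: "'a::euclidean_space set \<Rightarrow> 'a \<Rightarrow> 'a" where
  "coord_proj I u = (\<Sum>b\<in>I. (u \<bullet> b) *\<^sub>R b)"

lemma bounded_linear_coord_proj: "bounded_linear (coord_proj I)"
  unfolding coord_proj_def[abs_def]
  by (intro bounded_linear_sum bounded_linear_scaleR_const bounded_linear_inner_left)

lemmas coord_proj_linear = linear_diff[OF bounded_linear.linear[OF bounded_linear_coord_proj]]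
  linear_add[OF bounded_linear.linear[OF bounded_linear_coord_proj]]
  linear_scale[OF bounded_linear.linear[OF bounded_linear_coord_proj]]
  linear_0[OF bounded_linear.linear[OF bounded_linear_coord_proj]]

lemma inner_sum_coords:
  assumes "I \<subseteq> Basis" "b \<in> Basis"
  shows "(\<Sum>i\<in>I. f i *\<^sub>R i) \<bullet> b = (if b \<in> I then f b else 0)"
proof -
  have fin: "finite I" using assms(1) finite_Basis finite_subset by blast
  have "(\<Sum>i\<in>I. f i *\<^sub>R i) \<bullet> b = (\<Sum>i\<in>I. if i = b then f i else 0)"
    unfolding inner_sum_left
    by (rule sum.cong) (use assms in \<open>auto simp: inner_Basis\<close>)
  then show ?thesis using fin by (simp add: sum.delta')
qed

lemma coord_proj_inner:
  "I \<subseteq> Basis \<Longrightarrow> b \<in> Basis \<Longrightarrow> coord_proj I u \<bullet> b = (if b \<in> I then u \<bullet> b else 0)"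
  unfolding coord_proj_def by (rule inner_sum_coords)

lemma coord_proj_idem: "I \<subseteq> Basis \<Longrightarrow> coord_proj I (coord_proj I u) = coord_proj I u"
  by (rule euclidean_eqI) (simp add: coord_proj_inner)

lemma norm_coord_sum_le:
  fixes f :: "'a::euclidean_space \<Rightarrow> real" and r :: real
  assumes "I \<subseteq> Basis" "\<And>b. b \<in> I \<Longrightarrow> \<bar>f b\<bar> \<le> r"
  shows "norm (\<Sum>b\<in>I. f b *\<^sub>R b) \<le> card I * r"
  by (rule sum_norm_bound) (use assms in \<open>auto simp: subset_iff\<close>)

section \<open>Euler's scheme on the cells\<close>

text \<open>The last assumption keeps the scheme inside the ball where \<open>M\<close> is controlled: its steps have total
length at most the left-hand side. The two assumptions on \<open>coord_proj\<close> say that \<open>M y\<close> is a linear map from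
the coordinates in \<open>I\<close> to the others.\<close>

locale euler_scheme = fat_cantor \<rho> for \<rho> :: real +
  fixes I :: "'a::euclidean_space set" and M :: "'a \<Rightarrow> 'a \<Rightarrow>\<^sub>L 'a" and \<delta> m L :: real
  assumes I: "I \<subseteq> Basis"
    and M_bound: "y \<in> cball 0 \<delta> \<Longrightarrow> norm (M y) \<le> m"
    and M_lipschitz: "y \<in> cball 0 \<delta> \<Longrightarrow> z \<in> cball 0 \<delta> \<Longrightarrow> norm (M y - M z) \<le> L * norm (y - z)"
    and M_coord_proj: "M y (coord_proj I u) = M y u"
    and coord_proj_M: "coord_proj I (M y u) = 0"
    and m_nonneg: "0 \<le> m" and L_nonneg: "0 \<le> L"
    and \<rho>_small: "(1 + m) * card I * (2 * \<rho>) \<le> \<delta>"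
begin

lemma finite_I: "finite I"
  using I finite_Basis finite_subset by blast

definition cell_centre :: "nat \<Rightarrow> 'a \<Rightarrow> 'a" where
  "cell_centre n x = (\<Sum>b\<in>I. centre n (x \<bullet> b) *\<^sub>R b)"

text \<open>The point of the \<open>n\<close>-th approximating graph above the centre of the cell of \<open>x\<close>. From one centre
to the next it moves in the plane that \<open>M\<close> assigns to the present point.\<close>

primrec euler :: "nat \<Rightarrow> 'a \<Rightarrow> 'a" where
  "euler 0 x = 0"
| "euler (Suc n) x = euler n x + (cell_centre (Suc n) x - cell_centre n x) + M (euler n x) (cell_centre (Suc n) x - cell_centre n x)"

lemma cell_centre_inner: "b \<in> I \<Longrightarrow> cell_centre n x \<bullet> b = centre n (x \<bullet> b)"
  unfolding cell_centre_def using I by (subst inner_sum_coords) auto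

lemma norm_cell_centre_step: "norm (cell_centre (Suc n) x - cell_centre n x) \<le> card I * q (Suc n)"
proof -
  have "cell_centre (Suc n) x - cell_centre n x = (\<Sum>b\<in>I. (centre (Suc n) (x \<bullet> b) - centre n (x \<bullet> b)) *\<^sub>R b)"
    by (simp only: cell_centre_def scaleR_left_diff_distrib sum_subtractf)
  also have "norm \<dots> \<le> card I * q (Suc n)"
    using I q_pos[of "Suc n"] by (intro norm_coord_sum_le) (auto simp: centre.simps(2))
  finally show ?thesis .
qed

declare euler.simps(2)[simp del]

lemma norm_euler_step:
  assumes "euler n x \<in> cball 0 \<delta>"
  shows "norm (euler (Suc n) x - euler n x) \<le> (1 + m) * card I * q (Suc n)"
proof -
  let ?d = "cell_centre (Suc n) x - cell_centre n x"
  have "norm (euler (Suc n) x - euler n x) = norm (?d + M (euler n x) ?d)"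
    by (simp add: euler.simps(2))
  also have "\<dots> \<le> norm ?d + norm (M (euler n x)) * norm ?d"
    by (meson add_left_mono norm_blinfun norm_triangle_ineq order_trans)
  also have "\<dots> \<le> norm ?d + m * norm ?d"
    using M_bound[OF assms] by (intro add_left_mono mult_right_mono) auto
  also have "\<dots> = (1 + m) * norm ?d"
    by (simp add: algebra_simps)
  also have "\<dots> \<le> (1 + m) * (card I * q (Suc n))"
    using norm_cell_centre_step m_nonneg by (intro mult_left_mono) auto
  finally show ?thesis by (simp add: mult.assoc)
qed

lemma partial_radius_le: "(1 + m) * card I * (2 * \<rho> * (1 - (1/2) ^ n)) \<le> \<delta>"
proof -
  have "2 * \<rho> * (1 - (1/2) ^ n) \<le> 2 * \<rho> * 1"
    using \<rho>_pos by (intro mult_left_mono) auto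
  then have "(1 + m) * card I * (2 * \<rho> * (1 - (1/2) ^ n)) \<le> (1 + m) * card I * (2 * \<rho> * 1)"
    by (rule mult_left_mono) (use m_nonneg in simp)
  then show ?thesis
    using \<rho>_small by (simp only: mult_1_right)
qed

lemma norm_euler: "norm (euler n x) \<le> (1 + m) * card I * (2 * \<rho> * (1 - (1/2) ^ n))"
proof (induction n)
  case 0
  show ?case using m_nonneg by simp
next
  case (Suc n)
  have c: "0 \<le> (1 + m) * card I" using m_nonneg by simp
  have "euler n x \<in> cball 0 \<delta>"
    using order_trans[OF Suc partial_radius_le] by simp
  then have "norm (euler (Suc n) x) \<le> (1 + m) * card I * (2 * \<rho> * (1 - (1/2) ^ n)) + (1 + m) * card I * q (Suc n)"
    using norm_euler_step[of n x] Suc norm_triangle_sub[of "euler (Suc n) x" "euler n x"] by linarith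
  also have "\<dots> = (1 + m) * card I * (2 * \<rho> * (1 - (1/2) ^ n) + q (Suc n))"
    by (simp only: distrib_left)
  also have "\<dots> \<le> (1 + m) * card I * (2 * \<rho> * (1 - (1/2) ^ Suc n))"
  proof (intro mult_left_mono c)
    have "q (Suc n) \<le> \<rho> * (1/2) ^ n"
      using q_le[of "Suc n"] by simp
    then show "2 * \<rho> * (1 - (1/2) ^ n) + q (Suc n) \<le> 2 * \<rho> * (1 - (1/2) ^ Suc n)"
      by (simp add: algebra_simps)
  qed
  finally show ?case .
qed

lemma euler_in_ball: "euler n x \<in> cball 0 \<delta>"
  using order_trans[OF norm_euler partial_radius_le] by simp

definition slope_step :: "nat \<Rightarrow> 'a \<Rightarrow> 'a \<Rightarrow>\<^sub>L 'a" where
  "slope_step n x = M (euler (Suc n) x) - M (euler n x)"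

lemma norm_slope_step: "norm (slope_step n x) \<le> L * (1 + m) * card I * q (Suc n)"
proof -
  have "norm (slope_step n x) \<le> L * norm (euler (Suc n) x - euler n x)"
    unfolding slope_step_def by (intro M_lipschitz euler_in_ball)
  also have "\<dots> \<le> L * ((1 + m) * card I * q (Suc n))"
    by (intro mult_left_mono norm_euler_step euler_in_ball L_nonneg)
  finally show ?thesis by (simp add: mult.assoc)
qed

definition cell :: "nat \<Rightarrow> 'a \<Rightarrow> 'a set" where
  "cell n x = {y. \<forall>b\<in>I. \<bar>y \<bullet> b - centre n (x \<bullet> b)\<bar> < q n}"

text \<open>If \<open>x\<close> lies in the open cell around its centre, then the whole history of the scheme is constant on
that cell; so the correction made there is a cutoff times a fixed linear map.\<close>

lemma cell_centre_cell:
  assumes "x \<in> cell n x" "y \<in> cell n x" "i \<le> n"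
  shows "cell_centre i y = cell_centre i x"
proof -
  have "centre i (y \<bullet> b) = centre i (x \<bullet> b)" if "b \<in> I" for b
    using assms that by (intro centre_cell[of _ n]) (simp_all add: cell_def)
  then show ?thesis by (simp add: cell_centre_def)
qed

lemma euler_cell:
  assumes "x \<in> cell n x" "y \<in> cell n x" "i \<le> n"
  shows "euler i y = euler i x"
  using assms(3)
proof (induction i)
  case (Suc i)
  then show ?case using cell_centre_cell[OF assms(1,2)] by (simp add: euler.simps(2))
qed simp

lemma open_box: "open {y. \<forall>b\<in>I. \<bar>y \<bullet> b - c b\<bar> < r}"
proof -
  have "{y. \<forall>b\<in>I. \<bar>y \<bullet> b - c b\<bar> < r} = (\<Inter>b\<in>I. {y. \<bar>y \<bullet> b - c b\<bar> < r})"
    by auto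
  then show ?thesis
    using finite_I by (auto intro!: open_INT open_Collect_less continuous_intros)
qed

definition gap :: "nat \<Rightarrow> real" where
  "gap n = q n - 2 * q (Suc n)"

lemma gap_pos: "gap n > 0"
  using q_gap_pos[of n] by (simp add: gap_def)

text \<open>The step takes place in the middle third of the frame. Thus the cutoff is constantly \<open>1\<close> in a
neighbourhood of the subcells and constantly \<open>0\<close> in a neighbourhood of the boundary of the cell, and
its derivative vanishes at both places.\<close>

definition cutoff :: "nat \<Rightarrow> real \<Rightarrow> real" where
  "cutoff n t = smooth_step ((2 * q (Suc n) + 2 * gap n / 3 + 1 * t) / (gap n / 3))
    * smooth_step ((2 * q (Suc n) + 2 * gap n / 3 + (- 1) * t) / (gap n / 3))"

lemma cutoff_eq_1: "\<bar>t\<bar> \<le> 2 * q (Suc n) + gap n / 3 \<Longrightarrow> cutoff n t = 1"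
  unfolding cutoff_def using gap_pos[of n]
  by (simp add: smooth_step_ge_1 divide_simps)

lemma cutoff_eq_0: "\<bar>t\<bar> \<ge> 2 * q (Suc n) + 2 * gap n / 3 \<Longrightarrow> cutoff n t = 0"
  unfolding cutoff_def using gap_pos[of n]
  by (cases "t \<ge> 0") (auto intro!: smooth_step_le_0 divide_nonpos_pos)

lemma C11_on_cutoff:
  assumes "b \<in> Basis"
  shows "C11_on UNIV 1 (24 / gap n) ((24 / gap n)\<^sup>2) (\<lambda>x. cutoff n (x \<bullet> b - c))"
proof -
  let ?w = "gap n / 3"
  have w: "?w > 0" using gap_pos[of n] by simp
  have "C11_on UNIV 1 (4 / ?w * 1 + 4 / ?w) ((4 / ?w)\<^sup>2 * 1 + 2 * (4 / ?w) * (4 / ?w) + (4 / ?w)\<^sup>2)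
    (\<lambda>x. smooth_step ((2 * q (Suc n) + 2 * gap n / 3 + 1 * (x \<bullet> b - c)) / ?w)
      *\<^sub>R smooth_step ((2 * q (Suc n) + 2 * gap n / 3 + (- 1) * (x \<bullet> b - c)) / ?w))"
    by (rule C11_on_scaleR; rule C11_on_smooth_step_linear[OF assms w]; simp)
  moreover have "4 / ?w * 1 + 4 / ?w = 24 / gap n"
    "(4 / ?w)\<^sup>2 * 1 + 2 * (4 / ?w) * (4 / ?w) + (4 / ?w)\<^sup>2 = (24 / gap n)\<^sup>2"
    using gap_pos[of n] by (auto simp: field_simps power2_eq_square)
  ultimately show ?thesis
    unfolding cutoff_def by (simp only: real_scaleR_def)
qed

text \<open>The correction of level \<open>n\<close> lives on the cells of level \<open>n + 1\<close>, where the slope changes from the one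
at the parent's centre to the one at the cell's own centre.\<close>

definition correction :: "nat \<Rightarrow> 'a \<Rightarrow> 'a" where
  "correction n x = (\<Prod>b\<in>I. cutoff (Suc n) (x \<bullet> b - centre (Suc n) (x \<bullet> b)))
     *\<^sub>R slope_step n x (x - cell_centre (Suc n) x)"

lemma slope_step_coord_proj: "slope_step n x (coord_proj I u) = slope_step n x u"
  by (simp add: slope_step_def blinfun.diff_left M_coord_proj)

lemma coord_proj_slope_step: "coord_proj I (slope_step n x u) = 0"
  by (simp add: slope_step_def blinfun.diff_left coord_proj_linear coord_proj_M)

lemma correction_cell_eq:
  assumes "x \<in> cell (Suc n) x" "y \<in> cell (Suc n) x"
  shows "correction n y = (\<Prod>b\<in>I. cutoff (Suc n) (y \<bullet> b - centre (Suc n) (x \<bullet> b)))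
    *\<^sub>R slope_step n x (y - cell_centre (Suc n) x)"
proof -
  have "centre (Suc n) (y \<bullet> b) = centre (Suc n) (x \<bullet> b)" if "b \<in> I" for b
    using assms that by (intro centre_cell[of _ "Suc n"]) (simp_all add: cell_def)
  moreover have "slope_step n y = slope_step n x" "cell_centre (Suc n) y = cell_centre (Suc n) x"
    using euler_cell[OF assms] cell_centre_cell[OF assms] by (simp_all add: slope_step_def)
  ultimately show ?thesis by (simp add: correction_def)
qed

lemma C11_on_correction_cell:
  assumes x: "x \<in> cell (Suc n) x"
  defines "N \<equiv> Suc n" and "a \<equiv> L * (1 + m) * card I * q (Suc n)" and "\<beta> \<equiv> card I * (24 / gap (Suc n))"
  shows "C11_on (cell N x) (a * (real (card I) * q N)) (\<beta> * (a * (real (card I) * q N)) + a)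
     (\<beta>\<^sup>2 * (a * (real (card I) * q N)) + 2 * \<beta> * a + 0) (correction n)"
proof (rule C11_on_cong)
  let ?U = "cell N x" and ?A = "slope_step n x" and ?c = "cell_centre N x"
  have U: "open ?U"
    unfolding cell_def by (rule open_box)
  have a0: "0 \<le> a"
    using norm_slope_step[of n x] norm_ge_zero order_trans unfolding a_def by blast
  have nA: "norm ?A \<le> a" unfolding a_def by (rule norm_slope_step)
  have \<Phi>: "C11_on ?U 1 \<beta> (\<beta>\<^sup>2) (\<lambda>y. \<Prod>b\<in>I. cutoff N (y \<bullet> b - centre N (x \<bullet> b)))"
    unfolding \<beta>_def N_def
  proof (rule C11_on_prod[OF finite_I])
    show "open (cell (Suc n) x)" using U by (simp add: N_def)
    then show "C11_on (cell (Suc n) x) 1 (24 / gap (Suc n)) ((24 / gap (Suc n))\<^sup>2) (\<lambda>y. cutoff (Suc n) (y \<bullet> b - centre (Suc n) (x \<bullet> b)))"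
      if "b \<in> I" for b
      using that I by (intro C11_on_subset[OF C11_on_cutoff]) auto
  qed
  have "C11_on ?U (a * (real (card I) * q N)) a 0 (\<lambda>y. ?A (y - ?c))"
  proof (rule C11_onI[where g' = "\<lambda>_. ?A"])
    show "((\<lambda>y. ?A (y - ?c)) has_derivative blinfun_apply ?A) (at y)" for y
      by (auto intro!: derivative_eq_intros)
    show "norm (?A (z - ?c) - ?A (y - ?c)) \<le> a * norm (z - y)" for y z
    proof -
      have "?A (z - ?c) - ?A (y - ?c) = ?A (z - y)"
        by (simp add: blinfun.diff_right)
      then show ?thesis
        using norm_blinfun[of ?A "z - y"] nA by (metis mult_right_mono norm_ge_zero order_trans)
    qed
    fix y assume y: "y \<in> ?U"
    have "coord_proj I (y - ?c) = (\<Sum>b\<in>I. (y \<bullet> b - centre N (x \<bullet> b)) *\<^sub>R b)"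
      unfolding coord_proj_def by (rule sum.cong) (simp_all add: inner_diff_left cell_centre_inner)
    also have "norm \<dots> \<le> real (card I) * q N"
      using y I by (intro norm_coord_sum_le) (auto simp: cell_def less_imp_le)
    finally have "norm (coord_proj I (y - ?c)) \<le> real (card I) * q N" .
    then have "norm (?A (coord_proj I (y - ?c))) \<le> a * (real (card I) * q N)"
      using nA norm_blinfun[of ?A "coord_proj I (y - ?c)"] a0 by (meson mult_mono norm_ge_zero order_trans)
    then show "norm (?A (y - ?c)) \<le> a * (real (card I) * q N)"
      by (simp add: slope_step_coord_proj)
  qed (use U nA in auto)
  from C11_on_scaleR[OF \<Phi> this]
  show "C11_on (cell N x) (a * (real (card I) * q N)) (\<beta> * (a * (real (card I) * q N)) + a)
     (\<beta>\<^sup>2 * (a * (real (card I) * q N)) + 2 * \<beta> * a + 0)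
     (\<lambda>y. (\<Prod>b\<in>I. cutoff N (y \<bullet> b - centre N (x \<bullet> b))) *\<^sub>R ?A (y - ?c))" .
  show "correction n y = (\<Prod>b\<in>I. cutoff N (y \<bullet> b - centre N (x \<bullet> b))) *\<^sub>R ?A (y - ?c)" if "y \<in> ?U" for y
    using correction_cell_eq[OF x] that unfolding N_def .
qed

lemma correction_eq_0:
  assumes "b \<in> I" "\<bar>x \<bullet> b - centre (Suc n) (x \<bullet> b)\<bar> \<ge> 2 * q (Suc (Suc n)) + 2 * gap (Suc n) / 3"
  shows "correction n x = 0"
proof -
  have "(\<Prod>b\<in>I. cutoff (Suc n) (x \<bullet> b - centre (Suc n) (x \<bullet> b))) = 0"
    using finite_I assms cutoff_eq_0[OF assms(2)] by (intro prod_zero) auto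
  then show ?thesis by (simp only: correction_def scaleR_zero_left)
qed

text \<open>A point either lies in the open cell around its centre, or some coordinate of it is so far from the
centre that the correction vanishes in a neighbourhood. That the second set is open uses the
continuity of the folded distance.\<close>

lemma C11_on_correction:
  defines "a n \<equiv> L * (1 + m) * card I * q (Suc n)" and "\<beta> n \<equiv> card I * (24 / gap (Suc n))"
  shows "C11_on UNIV (a n * (real (card I) * q (Suc n))) (\<beta> n * (a n * (real (card I) * q (Suc n))) + a n)
     ((\<beta> n)\<^sup>2 * (a n * (real (card I) * q (Suc n))) + 2 * \<beta> n * a n + 0) (correction n)"
proof (rule C11_on_UNIV_if_local)
  fix x
  show "\<exists>U. x \<in> U \<and> C11_on U (a n * (real (card I) * q (Suc n))) (\<beta> n * (a n * (real (card I) * q (Suc n))) + a n)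
     ((\<beta> n)\<^sup>2 * (a n * (real (card I) * q (Suc n))) + 2 * \<beta> n * a n + 0) (correction n)"
  proof (cases "x \<in> cell (Suc n) x")
    case True
    then show ?thesis
      using C11_on_correction_cell[OF True] unfolding a_def \<beta>_def by blast
  next
    case False
    then obtain b where b: "b \<in> I" "q (Suc n) \<le> \<bar>x \<bullet> b - centre (Suc n) (x \<bullet> b)\<bar>"
      by (auto simp: cell_def not_less)
    let ?h = "\<lambda>y. \<bar>y \<bullet> b - centre (Suc n) (y \<bullet> b)\<bar>" and ?r = "2 * q (Suc (Suc n)) + 2 * gap (Suc n) / 3"
    have "continuous_on UNIV ?h"
      by (rule continuous_on_compose2[OF continuous_centre_dist]) (auto intro!: continuous_intros)
    then have op: "open {y. ?r < ?h y}"
      by (intro open_Collect_less) (auto intro: continuous_on_const)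
    have nonneg: "0 \<le> a n" "0 \<le> \<beta> n" "0 \<le> q (Suc n)"
      unfolding a_def \<beta>_def using L_nonneg m_nonneg q_pos[of "Suc n"] gap_pos[of "Suc n"] by simp_all
    have "C11_on {y. ?r < ?h y} (a n * (real (card I) * q (Suc n))) (\<beta> n * (a n * (real (card I) * q (Suc n))) + a n)
     ((\<beta> n)\<^sup>2 * (a n * (real (card I) * q (Suc n))) + 2 * \<beta> n * a n + 0) (\<lambda>y. 0 :: 'a)"
      using op nonneg by (intro C11_on_zero) auto
    then have "C11_on {y. ?r < ?h y} (a n * (real (card I) * q (Suc n))) (\<beta> n * (a n * (real (card I) * q (Suc n))) + a n)
     ((\<beta> n)\<^sup>2 * (a n * (real (card I) * q (Suc n))) + 2 * \<beta> n * a n + 0) (correction n)"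
      by (rule C11_on_cong) (simp add: correction_eq_0[OF b(1)])
    moreover have "x \<in> {y. ?r < ?h y}"
    proof -
      have "?r < q (Suc n)"
      proof -
        have "q (Suc n) = 2 * q (Suc (Suc n)) + gap (Suc n)"
          by (simp add: gap_def)
        then show ?thesis using gap_pos[of "Suc n"] by simp
      qed
      then show ?thesis using b(2) by simp
    qed
    ultimately show ?thesis by (intro exI[of _ "{y. ?r < ?h y}"] conjI)
  qed
qed

text \<open>With \<open>p = 2\<^sup>-\<^sup>n\<close> and \<open>s = (n + 3)\<^sup>2\<close>, the slope changes by \<open>O(p)\<close>, the cell has size \<open>O(p)\<close>, and the cutoff
acts on the scale \<open>p/s\<close>. So the derivative is \<open>O(p s)\<close> and its Lipschitz constant
\<open>O(p p (s/p)\<^sup>2) = O(s\<^sup>2)\<close>.\<close>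

lemma C11_on_correction_geometric:
  "\<exists>K E. \<forall>n. C11_on UNIV (K * (1/2) ^ n) (E * (real n + 3) ^ 4 * (1/2) ^ n) (E * (real n + 3) ^ 4) (correction n)"
proof -
  define k where "k = real (card I)"
  define a0 where "a0 = L * (1 + m) * k"
  have k: "0 \<le> k" and a0: "0 \<le> a0"
    using L_nonneg m_nonneg by (simp_all add: k_def a0_def)
  define K where "K = a0 * \<rho> * (k * \<rho>)"
  define E where "E = a0 * \<rho> * (48 * k\<^sup>2 + 1) + 48 * a0 * k * (48 * k\<^sup>2 + 2)"
  have "C11_on UNIV (K * (1/2) ^ n) (E * (real n + 3) ^ 4 * (1/2) ^ n) (E * (real n + 3) ^ 4) (correction n)" for n
  proof -
    define p :: real where "p = (1/2) ^ n"
    define s where "s = (real n + 3)\<^sup>2"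
    define \<beta> where "\<beta> = k * (24 / gap (Suc n))"
    let ?q = "q (Suc n)"
    have p: "0 < p" "p \<le> 1" by (auto simp: p_def power_le_one)
    have s: "1 \<le> s" unfolding s_def by (rule one_le_power) simp
    have s4: "(real n + 3) ^ 4 = s * s"
      by (simp add: s_def power2_eq_square power4_eq_xxxx)
    have s_le: "s \<le> s * s" using s by simp
    have q: "0 < ?q" "?q \<le> \<rho> * p"
      using q_pos q_le[of "Suc n"] by (auto simp: p_def)
    have \<beta>: "0 \<le> \<beta>"
      using k gap_pos[of "Suc n"] by (simp add: \<beta>_def)
    have gap: "gap (Suc n) = \<rho> * p / (2 * ((real n + 2) * (real n + 3)))"
      using q_gap[of "Suc n"] by (simp add: gap_def p_def add.commute mult_ac)
    have \<beta>q: "\<beta> * ?q \<le> 48 * k * s"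
    proof -
      have "24 / gap (Suc n) * ?q \<le> 24 / gap (Suc n) * (\<rho> * p)"
        using q gap_pos[of "Suc n"] by (intro mult_left_mono) auto
      also have "\<dots> = 48 * ((real n + 2) * (real n + 3))"
        unfolding gap using \<rho>_pos p by (simp add: field_simps)
      also have "\<dots> \<le> 48 * s"
        unfolding s_def power2_eq_square by (intro mult_left_mono mult_right_mono) auto
      finally have "k * (24 / gap (Suc n) * ?q) \<le> k * (48 * s)"
        using k by (rule mult_left_mono)
      then show ?thesis by (simp add: \<beta>_def mult_ac)
    qed
    have lin: "c * (48 * k * s) + d \<le> (48 * k * c + d) * s" if "0 \<le> c" "0 \<le> d" for c d
      using mult_left_mono[OF s that(2)] by (simp add: algebra_simps)
    have A: "a0 * ?q * (k * ?q) \<le> K * p"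
    proof -
      have "a0 * ?q * (k * ?q) \<le> a0 * (\<rho> * p) * (k * (\<rho> * 1))"
        using q p \<rho>_pos a0 k by (intro mult_mono order_trans[OF q(2)]) auto
      then show ?thesis by (simp add: K_def mult_ac)
    qed
    have B: "\<beta> * (a0 * ?q * (k * ?q)) + a0 * ?q \<le> E * (s * s) * p"
    proof -
      have "\<beta> * (a0 * ?q * (k * ?q)) + a0 * ?q = a0 * ?q * (k * (\<beta> * ?q) + 1)"
        by (simp add: algebra_simps)
      also have "\<dots> \<le> a0 * (\<rho> * p) * (k * (48 * k * s) + 1)"
      proof (rule mult_mono)
        show "a0 * ?q \<le> a0 * (\<rho> * p)"
          by (rule mult_left_mono[OF q(2) a0])
        show "k * (\<beta> * ?q) + 1 \<le> k * (48 * k * s) + 1"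
          using mult_left_mono[OF \<beta>q k] by simp
      qed (use a0 k \<rho>_pos p \<beta> q in auto)
      also have "\<dots> \<le> a0 * (\<rho> * p) * ((48 * k * k + 1) * s)"
        using a0 \<rho>_pos p k by (intro mult_left_mono lin) auto
      also have "\<dots> \<le> a0 * (\<rho> * p) * ((48 * k * k + 1) * (s * s))"
        using a0 \<rho>_pos p k s_le by (intro mult_left_mono) auto
      also have "\<dots> = a0 * \<rho> * (48 * k\<^sup>2 + 1) * (s * s) * p"
        by (simp add: power2_eq_square mult_ac)
      also have "\<dots> \<le> E * (s * s) * p"
        unfolding E_def using a0 k p s by (intro mult_right_mono) auto
      finally show ?thesis .
    qed
    have D: "\<beta>\<^sup>2 * (a0 * ?q * (k * ?q)) + 2 * \<beta> * (a0 * ?q) + 0 \<le> E * (s * s)"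
    proof -
      have "\<beta>\<^sup>2 * (a0 * ?q * (k * ?q)) + 2 * \<beta> * (a0 * ?q) + 0 = a0 * (\<beta> * ?q) * (k * (\<beta> * ?q) + 2)"
        by (simp add: algebra_simps power2_eq_square)
      also have "\<dots> \<le> a0 * (48 * k * s) * (k * (48 * k * s) + 2)"
      proof (rule mult_mono)
        show "a0 * (\<beta> * ?q) \<le> a0 * (48 * k * s)"
          by (rule mult_left_mono[OF \<beta>q a0])
        show "k * (\<beta> * ?q) + 2 \<le> k * (48 * k * s) + 2"
          using mult_left_mono[OF \<beta>q k] by simp
      qed (use a0 k s \<beta> q in auto)
      also have "\<dots> \<le> a0 * (48 * k * s) * ((48 * k * k + 2) * s)"
        using a0 k s by (intro mult_left_mono lin) auto
      also have "\<dots> = 48 * a0 * k * (48 * k\<^sup>2 + 2) * (s * s)"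
        by (simp add: power2_eq_square mult_ac)
      also have "\<dots> \<le> E * (s * s)"
        unfolding E_def using a0 k \<rho>_pos s by (intro mult_right_mono) auto
      finally show ?thesis .
    qed
    show ?thesis
      unfolding s4 p_def[symmetric]
      by (rule C11_on_mono[OF C11_on_correction]) (use A B D in \<open>simp_all only: a0_def \<beta>_def k_def\<close>)
  qed
  then show ?thesis by blast
qed

definition cantor_points :: "'a set" where
  "cantor_points = {x. \<forall>b\<in>I. x \<bullet> b \<in> cantor_set}"

text \<open>By \<open>cantor_setD\<close> such a point is in no frame, and then the cutoff is \<open>1\<close> in a neighbourhood.\<close>

lemma correction_on_cantor_points:
  assumes x: "x \<in> cantor_points"
  shows "correction n x = slope_step n x (x - cell_centre (Suc n) x)" "total_deriv (correction n) x = slope_step n x"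
proof -
  let ?N = "Suc n"
  let ?W = "{y. \<forall>b\<in>I. \<bar>y \<bullet> b - centre ?N (x \<bullet> b)\<bar> < 2 * q (Suc ?N) + gap ?N / 3}"
  have gap: "q ?N = 2 * q (Suc ?N) + gap ?N" "0 < gap ?N"
    using gap_pos[of ?N] by (auto simp: gap_def)
  have xW: "x \<in> ?W"
    using x cantor_setD[of _ ?N] gap(2) by (force simp: cantor_points_def)
  have W: "?W \<subseteq> cell ?N x"
    unfolding cell_def gap(1) using gap(2) by fastforce
  have eq: "correction n y = slope_step n x (y - cell_centre ?N x)" if y: "y \<in> ?W" for y
  proof -
    have "(\<Prod>b\<in>I. cutoff ?N (y \<bullet> b - centre ?N (x \<bullet> b))) = 1"
      by (rule prod.neutral) (use y in \<open>auto intro: cutoff_eq_1 less_imp_le\<close>)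
    then show ?thesis
      using correction_cell_eq[of x n y] W xW y by auto
  qed
  show "correction n x = slope_step n x (x - cell_centre ?N x)"
    by (rule eq[OF xW])
  have "((\<lambda>y. slope_step n x (y - cell_centre ?N x)) has_derivative blinfun_apply (slope_step n x)) (at x)"
    by (auto intro!: derivative_eq_intros)
  then have "(correction n has_derivative blinfun_apply (slope_step n x)) (at x)"
    by (rule has_derivative_transform_within_open[OF _ open_box xW]) (simp add: eq)
  then show "total_deriv (correction n) x = slope_step n x"
    by (rule total_deriv_eq)
qed

lemma correction_coord_proj: "correction n (coord_proj I x) = correction n x"
proof -
  have b: "coord_proj I x \<bullet> b = x \<bullet> b" if "b \<in> I" for b
    using that I by (subst coord_proj_inner) auto
  have c: "cell_centre i (coord_proj I x) = cell_centre i x" for i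
    unfolding cell_centre_def by (rule sum.cong) (simp_all add: b)
  have e: "euler i (coord_proj I x) = euler i x" for i
    by (induction i) (simp_all add: euler.simps(2) c)
  have "slope_step n x (coord_proj I x - cell_centre (Suc n) x) = slope_step n x (x - cell_centre (Suc n) x)"
    using slope_step_coord_proj[of n x x] by (simp add: blinfun.diff_right)
  then show ?thesis
    unfolding correction_def slope_step_def c e by (simp add: b)
qed

lemma coord_proj_correction: "coord_proj I (correction n x) = 0"
  by (simp add: correction_def coord_proj_linear coord_proj_slope_step)

definition graph_fun :: "'a \<Rightarrow> 'a" where
  "graph_fun x = M 0 x + (\<Sum>n. correction n x)"

definition graph_deriv :: "'a \<Rightarrow> 'a \<Rightarrow>\<^sub>L 'a" where
  "graph_deriv x = M 0 + (\<Sum>n. total_deriv (correction n) x)"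

lemma graph_fun_regularity:
  shows "summable (\<lambda>n. correction n x)" "summable (\<lambda>n. total_deriv (correction n) x)"
    "(graph_fun has_derivative blinfun_apply (graph_deriv x)) (at x)"
    "0 < \<alpha> \<Longrightarrow> \<alpha> < 1 \<Longrightarrow> \<exists>C. \<forall>x y. norm (graph_deriv x - graph_deriv y) \<le> C * dist x y powr \<alpha>"
proof -
  obtain K E where KE: "\<And>n. C11_on UNIV (K * (1/2) ^ n) (E * (real n + 3) ^ 4 * (1/2) ^ n) (E * (real n + 3) ^ 4) (correction n)"
    using C11_on_correction_geometric by blast
  have sum: "summable (\<lambda>n. E * (real n + 3) ^ 4 * r ^ n)" if "0 < r" "r < 1" for r :: real
    using summable_mult[OF summable_poly4_geometric[OF that], of E] by (simp only: mult.assoc)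
  note holder = C11_series_holder[where g = correction and E = "\<lambda>n. E * (real n + 3) ^ 4", OF KE sum]
  show "summable (\<lambda>n. correction n x)" "summable (\<lambda>n. total_deriv (correction n) x)"
    by (rule holder(1,2); assumption)+
  have "((\<lambda>x. \<Sum>n. correction n x) has_derivative blinfun_apply (\<Sum>n. total_deriv (correction n) x)) (at x)"
    by (rule holder(3))
  then have "((\<lambda>x. M 0 x + (\<Sum>n. correction n x)) has_derivative (\<lambda>h. M 0 h + blinfun_apply (\<Sum>n. total_deriv (correction n) x) h)) (at x)"
    by (intro has_derivative_add bounded_linear_imp_has_derivative blinfun.bounded_linear_right)
  then show "(graph_fun has_derivative blinfun_apply (graph_deriv x)) (at x)"
    unfolding graph_fun_def[abs_def] graph_deriv_def plus_blinfun.rep_eq .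
  show "\<exists>C. \<forall>x y. norm (graph_deriv x - graph_deriv y) \<le> C * dist x y powr \<alpha>" if "0 < \<alpha>" "\<alpha> < 1"
    using holder(4)[OF _ _ that] by (simp add: graph_deriv_def)
qed

lemma coord_proj_graph_fun: "coord_proj I (graph_fun x) = 0"
proof -
  have "coord_proj I (\<Sum>n. correction n x) = (\<Sum>n. coord_proj I (correction n x))"
    by (rule bounded_linear.suminf[OF bounded_linear_coord_proj graph_fun_regularity(1)])
  then show ?thesis
    by (simp add: graph_fun_def coord_proj_linear coord_proj_M coord_proj_correction)
qed

lemma graph_fun_coord_proj: "graph_fun (coord_proj I x) = graph_fun x"
  by (simp add: graph_fun_def correction_coord_proj M_coord_proj)

text \<open>The partial sums are the affine approximations of the cells that contain \<open>x\<close>: slope \<open>M\<close> at the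
Euler point, and the value at the centre equal to the component of the Euler point outside \<open>I\<close>. As
the centres converge to \<open>P x\<close>, the Euler points converge to \<open>P x + f x\<close>, and the slopes to \<open>M\<close>
there.\<close>

lemma graph_fun_on_cantor_points:
  assumes x: "x \<in> cantor_points"
  shows "coord_proj I x + graph_fun x \<in> cball 0 \<delta>"
    and "graph_deriv x = M (coord_proj I x + graph_fun x)"
proof -
  let ?p = "coord_proj I x"
  \<comment> \<open>The left-hand side is the \<open>j\<close>-th approximation. Moving the base point from one centre to the next is exactly a step of the scheme.\<close>
  have partial: "M 0 x + (\<Sum>n<j. correction n x) = euler j x - cell_centre j x + M (euler j x) (?p - cell_centre j x)" for j
  proof (induction j)
    case 0
    have "cell_centre 0 x = 0" by (simp add: cell_centre_def)
    then show ?case by (simp add: M_coord_proj)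
  next
    case (Suc j)
    have "correction j x = slope_step j x (?p - cell_centre (Suc j) x)"
      unfolding correction_on_cantor_points(1)[OF x] by (simp add: blinfun.diff_right slope_step_coord_proj)
    then have "M 0 x + (\<Sum>n<Suc j. correction n x)
        = euler j x - cell_centre j x + M (euler j x) (?p - cell_centre j x) + slope_step j x (?p - cell_centre (Suc j) x)"
      using Suc by (simp add: add.assoc[symmetric])
    also have "\<dots> = euler (Suc j) x - cell_centre (Suc j) x + M (euler (Suc j) x) (?p - cell_centre (Suc j) x)"
      unfolding slope_step_def by (simp add: euler.simps(2)[of j] blinfun.diff_left blinfun.diff_right)
    finally show ?case .
  qed
  have cell_centre: "(\<lambda>j. cell_centre j x) \<longlonglongrightarrow> ?p"
    unfolding cell_centre_def coord_proj_def
    by (intro tendsto_sum tendsto_scaleR tendsto_const centre_tendsto) (use x in \<open>simp add: cantor_points_def\<close>)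
  have "(\<lambda>j. M (euler j x) (?p - cell_centre j x)) \<longlonglongrightarrow> 0"
  proof (rule tendsto_0_le[where K = m])
    show "(\<lambda>j. ?p - cell_centre j x) \<longlonglongrightarrow> 0"
      using tendsto_diff[OF tendsto_const cell_centre, of ?p] by simp
    show "\<forall>\<^sub>F j in sequentially. norm (M (euler j x) (?p - cell_centre j x)) \<le> norm (?p - cell_centre j x) * m"
    proof (intro always_eventually allI)
      fix j
      have "norm (M (euler j x) (?p - cell_centre j x)) \<le> norm (M (euler j x)) * norm (?p - cell_centre j x)"
        by (rule norm_blinfun)
      also have "\<dots> \<le> m * norm (?p - cell_centre j x)"
        by (intro mult_right_mono M_bound euler_in_ball norm_ge_zero)
      finally show "norm (M (euler j x) (?p - cell_centre j x)) \<le> norm (?p - cell_centre j x) * m"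
        by (simp add: mult.commute)
    qed
  qed
  moreover have "(\<lambda>j. M 0 x + (\<Sum>n<j. correction n x)) \<longlonglongrightarrow> graph_fun x"
    unfolding graph_fun_def by (intro tendsto_intros summable_LIMSEQ graph_fun_regularity)
  ultimately have "(\<lambda>j. (M 0 x + (\<Sum>n<j. correction n x)) - M (euler j x) (?p - cell_centre j x) + cell_centre j x) \<longlonglongrightarrow> graph_fun x - 0 + ?p"
    by (intro tendsto_intros cell_centre)
  then have euler: "(\<lambda>j. euler j x) \<longlonglongrightarrow> ?p + graph_fun x"
    unfolding partial by (simp add: add.commute)
  show ball: "?p + graph_fun x \<in> cball 0 \<delta>"
    by (rule closed_sequentially[OF closed_cball _ euler]) (simp only: euler_in_ball)
  have "(\<lambda>j. M (euler j x) - M (?p + graph_fun x)) \<longlonglongrightarrow> 0"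
  proof (rule tendsto_0_le[where K = L])
    show "(\<lambda>j. euler j x - (?p + graph_fun x)) \<longlonglongrightarrow> 0"
      using euler by (rule LIM_zero)
    show "\<forall>\<^sub>F j in sequentially. norm (M (euler j x) - M (?p + graph_fun x)) \<le> norm (euler j x - (?p + graph_fun x)) * L"
      using M_lipschitz[OF euler_in_ball ball] by (simp add: mult.commute)
  qed
  then have "(\<lambda>j. M (euler j x)) \<longlonglongrightarrow> M (?p + graph_fun x)"
    by (rule LIM_zero_cancel)
  moreover have "M (euler j x) = M 0 + (\<Sum>n<j. total_deriv (correction n) x)" for j
    by (induction j) (simp_all add: correction_on_cantor_points(2)[OF x] slope_step_def)
  moreover have "(\<lambda>j. M 0 + (\<Sum>n<j. total_deriv (correction n) x)) \<longlonglongrightarrow> graph_deriv x"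
    unfolding graph_deriv_def by (intro tendsto_intros summable_LIMSEQ graph_fun_regularity)
  ultimately show "graph_deriv x = M (?p + graph_fun x)"
    using LIMSEQ_unique by simp
qed

end

section \<open>A lower bound for Hausdorff measure\<close>

lemma emeasure_lborel_coordinate_box:
  fixes A :: "'a::euclidean_space \<Rightarrow> real set"
  assumes A: "\<And>b. b \<in> Basis \<Longrightarrow> A b \<in> sets borel"
  shows "{x. \<forall>b\<in>Basis. x \<bullet> b \<in> A b} \<in> sets (lborel :: 'a measure)"
    and "emeasure lborel {x. \<forall>b\<in>Basis. x \<bullet> b \<in> A b} = (\<Prod>b\<in>Basis. emeasure lborel (A b))"
proof -
  let ?S = "{x :: 'a. \<forall>b\<in>Basis. x \<bullet> b \<in> A b}"
  let ?g = "\<lambda>f. \<Sum>b\<in>Basis. f b *\<^sub>R (b :: 'a)"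
  interpret product_sigma_finite "\<lambda>_::'a. lborel :: real measure"
    by standard
  have "?S = (\<Inter>b\<in>Basis. (\<lambda>x. x \<bullet> b) -` A b \<inter> space borel)"
    by auto
  also have "\<dots> \<in> sets (borel :: 'a measure)"
    using A by (intro sets.finite_INT measurable_sets[OF borel_measurable_inner]) auto
  finally have S: "?S \<in> sets (borel :: 'a measure)" .
  then show "?S \<in> sets (lborel :: 'a measure)" by simp
  have "emeasure (lborel :: 'a measure) ?S
      = emeasure (distr (\<Pi>\<^sub>M b\<in>(Basis :: 'a set). lborel :: real measure) (borel :: 'a measure) ?g) ?S"
    by (rule arg_cong[where f = "\<lambda>N. emeasure N ?S", OF lborel_eq])
  also have "\<dots> = emeasure (\<Pi>\<^sub>M b\<in>(Basis :: 'a set). lborel :: real measure)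
      (?g -` ?S \<inter> space (\<Pi>\<^sub>M b\<in>(Basis :: 'a set). lborel :: real measure))"
    by (rule emeasure_distr[OF _ S]) measurable
  also have "?g -` ?S \<inter> space (\<Pi>\<^sub>M b\<in>(Basis :: 'a set). lborel :: real measure) = Pi\<^sub>E Basis A"
    by (auto simp: space_PiM PiE_def)
  also have "emeasure (\<Pi>\<^sub>M b\<in>(Basis :: 'a set). lborel :: real measure) (Pi\<^sub>E Basis A)
      = (\<Prod>b\<in>Basis. emeasure lborel (A b))"
    using A by (intro emeasure_PiM) auto
  finally show "emeasure lborel ?S = (\<Prod>b\<in>Basis. emeasure lborel (A b))" .
qed

lemma prod_ennreal_pos:
  fixes f :: "'i \<Rightarrow> ennreal"
  assumes "\<And>i. i \<in> A \<Longrightarrow> 0 < f i"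
  shows "0 < prod f A"
  using assms by (induction A rule: infinite_finite_induct) (auto simp: ennreal_zero_less_mult_iff)

text \<open>A covering of \<open>T\<close> gives a covering of a cylinder over the projection of \<open>T\<close>: replace each set \<open>E\<close>
by the box with sides of length \<open>2 * diameter E\<close> in the directions of \<open>I\<close> and unit intervals in the
others. The volume of this box is the gauge of \<open>E\<close> up to a constant.\<close>

lemma hausdorff_measure_pos_if_projection:
  fixes T I :: "'a::euclidean_space set"
  assumes I: "I \<subseteq> Basis" and C: "C \<in> sets borel" "0 < emeasure lborel C"
    and T: "\<And>x. (\<And>b. b \<in> I \<Longrightarrow> x \<bullet> b \<in> C) \<Longrightarrow> \<exists>y\<in>T. \<forall>b\<in>I. y \<bullet> b = x \<bullet> b"
  shows "0 < hausdorff_measure (card I) T"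
proof -
  \<comment> \<open>Unit intervals in the directions outside \<open>I\<close> turn \<open>k\<close>-dimensional volume into volume of the whole space.\<close>
  define box where "box A = {x :: 'a. \<forall>b\<in>Basis. x \<bullet> b \<in> (if b \<in> I then A b else {0..1})}" for A
  have box: "box A \<in> sets lborel" "emeasure lborel (box A) = (\<Prod>b\<in>I. emeasure lborel (A b))"
    if "\<And>b. A b \<in> sets borel" for A
  proof -
    have s: "(if b \<in> I then A b else {0..1}) \<in> sets borel" for b
      using that by simp
    show "box A \<in> sets lborel"
      unfolding box_def by (rule emeasure_lborel_coordinate_box(1)) (rule s)
    have "emeasure lborel (box A) = (\<Prod>b\<in>Basis. emeasure lborel (if b \<in> I then A b else {0..1}))"
      unfolding box_def by (rule emeasure_lborel_coordinate_box(2)) (rule s)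
    also have "\<dots> = (\<Prod>b\<in>Basis. if b \<in> I then emeasure lborel (A b) else 1)"
      by (rule prod.cong) auto
    also have "\<dots> = (\<Prod>b\<in>I. emeasure lborel (A b))"
      using I by (simp add: prod.If_cases Int_absorb1)
    finally show "emeasure lborel (box A) = (\<Prod>b\<in>I. emeasure lborel (A b))" .
  qed
  define K where "K = box (\<lambda>_. C)"
  have K: "0 < emeasure lborel K"
  proof -
    have "0 < (\<Prod>b\<in>I. emeasure lborel C)"
      using C(2) by (rule prod_ennreal_pos)
    then show ?thesis by (simp only: K_def box(2)[OF C(1)])
  qed
  \<comment> \<open>The gauge of a nonempty set of diameter \<open>d\<close> is \<open>w * (2 * d)\<^sup>k\<close>.\<close>
  define w where "w = unit_ball_vol (real (card I)) / 4 ^ card I"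
  have w: "0 < w" by (simp add: w_def unit_ball_vol_pos)
  have "ennreal w * emeasure lborel K \<le> hausdorff_premeasure (card I) 1 T"
    unfolding hausdorff_premeasure_def
  proof (rule INF_greatest)
    fix E :: "nat \<Rightarrow> 'a set"
    assume "E \<in> {E. T \<subseteq> (\<Union>i. E i) \<and> (\<forall>i. bounded (E i) \<and> diameter (E i) \<le> 1)}"
    then have cover: "T \<subseteq> (\<Union>i. E i)" and bdd: "\<And>i. bounded (E i)" by auto
    define B where "B i = (if E i = {} then {} else
        box (\<lambda>b. cbox ((SOME y. y \<in> E i) \<bullet> b - diameter (E i)) ((SOME y. y \<in> E i) \<bullet> b + diameter (E i))))" for i
    have sets: "B i \<in> sets lborel" for i
    proof (cases "E i = {}")
      case False
      then show ?thesis
        unfolding B_def by (simp only: if_False) (rule box(1), rule borel_closed, rule closed_cbox)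
    qed (simp add: B_def)
    have gauge: "ennreal w * emeasure lborel (B i) = hausdorff_gauge (card I) (E i)" for i
    proof (cases "E i = {}")
      case True
      then show ?thesis by (simp add: B_def hausdorff_gauge_def)
    next
      case False
      have d: "0 \<le> diameter (E i)" by (rule diameter_ge_0[OF bdd])
      have "emeasure lborel (B i) = (\<Prod>b\<in>I. ennreal (2 * diameter (E i)))"
        using False d by (simp add: B_def box(2) cbox_interval)
      also have "\<dots> = ennreal ((2 * diameter (E i)) ^ card I)"
        using d by (simp add: ennreal_power)
      finally have "ennreal w * emeasure lborel (B i) = ennreal (w * (2 * diameter (E i)) ^ card I)"
        using w d by (simp add: ennreal_mult)
      also have "w * (2 * diameter (E i)) ^ card I = unit_ball_vol (real (card I)) * (diameter (E i) / 2) ^ card I"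
      proof -
        have "(2 * diameter (E i)) ^ card I = (4 * (diameter (E i) / 2)) ^ card I"
          by simp
        also have "\<dots> = 4 ^ card I * (diameter (E i) / 2) ^ card I"
          by (rule power_mult_distrib)
        finally show ?thesis by (simp add: w_def)
      qed
      finally show ?thesis using False by (simp add: hausdorff_gauge_def)
    qed
    have "K \<subseteq> (\<Union>i. B i)"
    proof
      fix x assume x: "x \<in> K"
      have "\<exists>y\<in>T. \<forall>b\<in>I. y \<bullet> b = x \<bullet> b"
      proof (rule T)
        fix b assume b: "b \<in> I"
        then have "b \<in> Basis" using I by blast
        then show "x \<bullet> b \<in> C"
          using x b by (auto simp: K_def box_def)
      qed
      then obtain y i where y: "\<And>b. b \<in> I \<Longrightarrow> y \<bullet> b = x \<bullet> b" "y \<in> E i"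
        using cover by blast
      define y0 where "y0 = (SOME y. y \<in> E i)"
      have y0: "y0 \<in> E i"
        unfolding y0_def using y(2) by (rule someI)
      have "\<bar>x \<bullet> b - y0 \<bullet> b\<bar> \<le> diameter (E i)" if b: "b \<in> I" for b
      proof -
        have "\<bar>(y - y0) \<bullet> b\<bar> \<le> norm (y - y0)"
          using b I by (intro Basis_le_norm) auto
        also have "\<dots> \<le> diameter (E i)"
          using diameter_bounded_bound[OF bdd y(2) y0] by (simp add: dist_norm)
        finally show ?thesis using y(1)[OF b] by (simp add: inner_diff_left)
      qed
      then have "x \<in> B i"
        using x y(2) by (auto simp: B_def box_def K_def y0_def[symmetric] abs_le_iff cbox_interval split: if_splits)
          (smt (verit))+
      then show "x \<in> (\<Union>i. B i)" by blast
    qed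
    then have "emeasure lborel K \<le> emeasure lborel (\<Union>i. B i)"
      using sets by (intro emeasure_mono sets.countable_UN) auto
    also have "\<dots> \<le> (\<Sum>i. emeasure lborel (B i))"
      using sets by (intro emeasure_subadditive_countably) auto
    finally have "ennreal w * emeasure lborel K \<le> ennreal w * (\<Sum>i. emeasure lborel (B i))"
      by (rule mult_left_mono) simp
    also have "\<dots> = (\<Sum>i. hausdorff_gauge (card I) (E i))"
      by (simp only: ennreal_suminf_cmult[symmetric] gauge)
    finally show "ennreal w * emeasure lborel K \<le> (\<Sum>i. hausdorff_gauge (card I) (E i))" .
  qed
  also have "\<dots> \<le> hausdorff_measure (card I) T"
    unfolding hausdorff_measure_def by (rule SUP_upper) simp
  finally have "ennreal w * emeasure lborel K \<le> hausdorff_measure (card I) T" .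
  moreover have "0 < ennreal w * emeasure lborel K"
    using w K by (simp add: ennreal_zero_less_mult_iff)
  ultimately show ?thesis by (rule less_le_trans[rotated])
qed

section \<open>A distribution of planes as a family of graphs\<close>

text \<open>A basis of \<open>V0\<close> can be completed to a basis of the space by coordinate vectors. The remaining
coordinate vectors form \<open>I\<close>; the coordinate projection onto their span is then injective on \<open>V0\<close>.\<close>

lemma coordinate_complement:
  fixes V0 :: "'a::euclidean_space set"
  assumes "subspace V0"
  obtains I where "I \<subseteq> Basis" "card I = dim V0" "span (V0 \<union> (Basis - I)) = UNIV"
proof -
  obtain B where B: "B \<subseteq> V0" "independent B" "V0 \<subseteq> span B" "card B = dim V0"
    using basis_exists by blast
  obtain B' where B': "B \<subseteq> B'" "B' \<subseteq> B \<union> Basis" "independent B'" "B \<union> Basis \<subseteq> span B'"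
    using maximal_independent_subset_extend[of B "B \<union> Basis"] B(2) by blast
  have span: "span B' = UNIV"
    using B'(4) span_mono[of Basis "span B'"] by (auto simp: span_span)
  have card: "card B' = DIM('a)"
    using dim_unique[of B' UNIV] B'(3) span by (metis dim_UNIV subset_UNIV top_greatest)
  have fin: "finite B'"
    using B'(3) by (rule independent_imp_finite)
  define J where "J = B' - B"
  have J: "J \<subseteq> Basis" using B'(2) by (auto simp: J_def)
  have "card J = DIM('a) - dim V0"
    using B'(1) fin card B(4) by (simp add: J_def card_Diff_subset finite_subset)
  then have "card (Basis - J) = dim V0"
    using J dim_subset_UNIV[of V0] by (simp add: card_Diff_subset finite_subset[OF J])
  moreover have "span (V0 \<union> (Basis - (Basis - J))) = UNIV"
  proof -
    have "B' \<subseteq> V0 \<union> (Basis - (Basis - J))"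
      using B(1) J by (auto simp: J_def)
    then show ?thesis
      using span span_mono by blast
  qed
  ultimately show ?thesis
    using that[of "Basis - J"] by blast
qed

lemma C1_on_lipschitz_near:
  fixes X :: "'a::euclidean_space \<Rightarrow> 'b::real_normed_vector"
  assumes X: "C1_on U X" and p: "p \<in> U"
  obtains \<delta> L where "0 < \<delta>" "0 \<le> L" "cball p \<delta> \<subseteq> U"
    "\<And>x y. x \<in> cball p \<delta> \<Longrightarrow> y \<in> cball p \<delta> \<Longrightarrow> norm (X x - X y) \<le> L * norm (x - y)"
proof -
  obtain X' where U: "open U" and X': "\<And>x. x \<in> U \<Longrightarrow> (X has_derivative blinfun_apply (X' x)) (at x)"
    and cont: "continuous_on U X'"
    using X by (auto simp: C1_on_def)
  obtain \<delta> where \<delta>: "0 < \<delta>" "cball p \<delta> \<subseteq> U"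
    using U p open_contains_cball by blast
  have "bounded (X' ` cball p \<delta>)"
    by (intro compact_imp_bounded compact_continuous_image continuous_on_subset[OF cont] \<delta> compact_cball)
  then obtain L where L: "\<And>x. x \<in> cball p \<delta> \<Longrightarrow> norm (X' x) \<le> L"
    unfolding bounded_iff by blast
  have "0 \<le> L"
    using order_trans[OF norm_ge_zero L[of p]] \<delta>(1) by simp
  moreover have "norm (X x - X y) \<le> L * norm (x - y)" if "x \<in> cball p \<delta>" "y \<in> cball p \<delta>" for x y
  proof (rule differentiable_bound[OF convex_cball _ _ that])
    fix z assume z: "z \<in> cball p \<delta>"
    then show "(X has_derivative blinfun_apply (X' z)) (at z within cball p \<delta>)"
      using X' \<delta>(2) has_derivative_at_withinI by blast
    show "onorm (blinfun_apply (X' z)) \<le> L"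
      using L[OF z] by (simp add: norm_blinfun.rep_eq)
  qed
  ultimately show ?thesis
    using that[OF \<delta>(1) _ \<delta>(2)] by blast
qed

lemma C1_family_lipschitz_near:
  fixes X :: "'i \<Rightarrow> 'a::euclidean_space \<Rightarrow> 'b::real_normed_vector"
  assumes "finite A" and "\<And>i. i \<in> A \<Longrightarrow> C1_on U (X i)" and "open U" "p \<in> U"
  shows "\<exists>\<delta> L. 0 < \<delta> \<and> 0 \<le> L \<and> cball p \<delta> \<subseteq> U \<and>
    (\<forall>i\<in>A. \<forall>x\<in>cball p \<delta>. \<forall>y\<in>cball p \<delta>. norm (X i x - X i y) \<le> L * norm (x - y))"
  using assms(1,2)
proof (induction A)
  case empty
  obtain \<delta> where "0 < \<delta>" "cball p \<delta> \<subseteq> U"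
    using assms(3,4) open_contains_cball by blast
  then show ?case by (intro exI[of _ \<delta>] exI[of _ 0]) simp
next
  case (insert i A)
  obtain \<delta> L where 1: "0 < \<delta>" "0 \<le> L" "cball p \<delta> \<subseteq> U"
    "\<And>i x y. i \<in> A \<Longrightarrow> x \<in> cball p \<delta> \<Longrightarrow> y \<in> cball p \<delta> \<Longrightarrow> norm (X i x - X i y) \<le> L * norm (x - y)"
    using insert.IH insert.prems by (metis insertI2)
  have "C1_on U (X i)" using insert.prems by blast
  from C1_on_lipschitz_near[OF this \<open>p \<in> U\<close>]
  obtain \<delta>' L' where 2: "0 < \<delta>'" "0 \<le> L'"
    "\<And>x y. x \<in> cball p \<delta>' \<Longrightarrow> y \<in> cball p \<delta>' \<Longrightarrow> norm (X i x - X i y) \<le> L' * norm (x - y)"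
    by metis
  have "norm (X j x - X j y) \<le> (L + L') * norm (x - y)"
    if "j \<in> insert i A" "x \<in> cball p (min \<delta> \<delta>')" "y \<in> cball p (min \<delta> \<delta>')" for j x y
  proof (cases "j = i")
    case True
    then have "norm (X j x - X j y) \<le> L' * norm (x - y)"
      using 2(3) that by auto
    also have "\<dots> \<le> (L + L') * norm (x - y)"
      using 1(2) by (intro mult_right_mono) auto
    finally show ?thesis .
  next
    case False
    then have "norm (X j x - X j y) \<le> L * norm (x - y)"
      using 1(4) that by auto
    also have "\<dots> \<le> (L + L') * norm (x - y)"
      using 2(2) by (intro mult_right_mono) auto
    finally show ?thesis .
  qed
  moreover have "cball p (min \<delta> \<delta>') \<subseteq> U"
    using 1(3) by auto
  ultimately show ?case
    using 1(1,2) 2(1,2) by (intro exI[of _ "min \<delta> \<delta>'"] exI[of _ "L + L'"]) auto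
qed

lemma norm_coord_proj_le:
  assumes "I \<subseteq> Basis"
  shows "norm (coord_proj I u) \<le> card I * norm u"
  unfolding coord_proj_def using assms by (intro norm_coord_sum_le) (auto simp: Basis_le_norm)

lemma dim_range_coord_proj:
  fixes I :: "'a::euclidean_space set"
  assumes "I \<subseteq> Basis"
  shows "card I \<le> dim (range (coord_proj I))"
proof -
  have "I \<subseteq> range (coord_proj I)"
  proof
    fix b assume b: "b \<in> I"
    have "coord_proj I b = b"
      by (rule euclidean_eqI) (use b assms in \<open>auto simp: coord_proj_inner inner_Basis\<close>)
    then show "b \<in> range (coord_proj I)" by (metis rangeI)
  qed
  moreover have "card I = dim I"
    using independent_mono[OF independent_Basis assms] by (simp add: dim_eq_card_independent)
  ultimately show ?thesis by (simp add: dim_subset)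
qed

text \<open>Let \<open>T y\<close> map the coordinate vectors in \<open>I\<close> to the spanning fields at \<open>y\<close> and fix the others. It is
invertible at \<open>0\<close>, hence near \<open>0\<close>, where its inverse \<open>S y\<close> is bounded and Lipschitz in \<open>y\<close> like \<open>T\<close>
itself. If \<open>u\<close> is in the span of \<open>I\<close> and \<open>w = S y u\<close>, then \<open>T y\<close> maps the part \<open>P w\<close> of \<open>w\<close> into
\<open>V y\<close> and fixes \<open>w - P w\<close>. So \<open>u + (P w - w)\<close> is the point of \<open>V y\<close> above \<open>u\<close>.\<close>

lemma plane_distribution_graph:
  fixes V :: "'a::euclidean_space \<Rightarrow> 'a set"
  assumes V: "C1_plane_distribution k V"
  obtains I M \<delta> m L where "I \<subseteq> Basis" "card I = k" "0 < \<delta>" "0 \<le> m" "0 \<le> L"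
    "\<And>y. y \<in> cball 0 \<delta> \<Longrightarrow> norm (M y :: 'a \<Rightarrow>\<^sub>L 'a) \<le> m"
    "\<And>y z. y \<in> cball 0 \<delta> \<Longrightarrow> z \<in> cball 0 \<delta> \<Longrightarrow> norm (M y - M z) \<le> L * norm (y - z)"
    "\<And>y u. M y (coord_proj I u) = M y u" "\<And>y u. coord_proj I (M y u) = 0"
    "\<And>y. y \<in> cball 0 \<delta> \<Longrightarrow> V y = range (\<lambda>u. coord_proj I u + M y u)"
proof -
  have subV: "subspace (V x)" and dimV: "dim (V x) = k" for x
    using V by (auto simp: C1_plane_distribution_def)
  have "\<exists>U X. open U \<and> 0 \<in> U \<and> (\<forall>i<k. C1_on U (X i)) \<and> (\<forall>x\<in>U. V x = span {X i x |i. i < k})"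
    by (rule V[unfolded C1_plane_distribution_def, THEN conjunct2, THEN spec])
  then obtain U X where U: "open U" "0 \<in> U" and X: "\<And>i. i < k \<Longrightarrow> C1_on U (X i)"
    and VX: "\<And>x. x \<in> U \<Longrightarrow> V x = span {X i x |i. i < k}"
    by blast
  obtain I where I: "I \<subseteq> Basis" "card I = k" "span (V 0 \<union> (Basis - I)) = UNIV"
    using coordinate_complement[OF subV[of 0]] dimV by metis
  have finI: "finite I" using I(1) finite_Basis finite_subset by blast
  let ?P = "coord_proj I"
  obtain h where h: "bij_betw h I {0..<k}"
    using ex_bij_betw_finite_nat[OF finI] I(2) by auto
  then have hk: "h b < k" if "b \<in> I" for b
    using that by (auto simp: bij_betw_def)
  obtain \<delta>1 K0 where \<delta>1: "0 < \<delta>1" "0 \<le> K0" "cball 0 \<delta>1 \<subseteq> U"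
    and X_lip: "\<And>i x y. i \<in> {0..<k} \<Longrightarrow> x \<in> cball 0 \<delta>1 \<Longrightarrow> y \<in> cball 0 \<delta>1 \<Longrightarrow> norm (X i x - X i y) \<le> K0 * norm (x - y)"
    using C1_family_lipschitz_near[of "{0..<k}" U X 0] X U by auto
  define T where "T y u = (\<Sum>b\<in>I. (u \<bullet> b) *\<^sub>R X (h b) y) + (u - ?P u)" for y u
  have linT: "linear (T y)" for y
    unfolding T_def
    by (intro bounded_linear.linear bounded_linear_add bounded_linear_sub bounded_linear_sum bounded_linear_ident
        bounded_linear_scaleR_const bounded_linear_inner_left bounded_linear_coord_proj)
  define K where "K = card I * K0"
  have K: "0 \<le> K" using \<delta>1 by (simp add: K_def)
  have T_lip: "norm (T y u - T z u) \<le> K * norm (y - z) * norm u"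
    if "y \<in> cball 0 \<delta>1" "z \<in> cball 0 \<delta>1" for y z u
  proof -
    have "T y u - T z u = (\<Sum>b\<in>I. (u \<bullet> b) *\<^sub>R (X (h b) y - X (h b) z))"
      by (simp add: T_def scaleR_right_diff_distrib sum_subtractf)
    also have "norm \<dots> \<le> real (card I) * (norm u * (K0 * norm (y - z)))"
    proof (rule sum_norm_bound)
      fix b assume b: "b \<in> I"
      show "norm ((u \<bullet> b) *\<^sub>R (X (h b) y - X (h b) z)) \<le> norm u * (K0 * norm (y - z))"
        unfolding norm_scaleR using b I(1) hk[OF b] X_lip[OF _ that]
        by (intro mult_mono) (auto simp: Basis_le_norm)
    qed
    finally show ?thesis by (simp add: K_def mult_ac)
  qed
  have "range (T 0) = UNIV"
  proof -
    have sub: "subspace (range (T 0))"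
      by (intro linear_subspace_image linT subspace_UNIV)
    have "X i 0 \<in> range (T 0)" if i: "i < k" for i
    proof -
      obtain b where b: "b \<in> I" "h b = i"
        using h i by (auto simp: bij_betw_def image_iff) (metis atLeastLessThan_iff imageE zero_le)
      have "?P b = b"
        by (rule euclidean_eqI) (use b I in \<open>auto simp: coord_proj_inner inner_Basis\<close>)
      moreover have "(\<Sum>b'\<in>I. (b \<bullet> b') *\<^sub>R X (h b') 0) = (\<Sum>b'\<in>I. if b' = b then X (h b') 0 else 0)"
        by (rule sum.cong) (use b I in \<open>auto simp: inner_Basis subset_iff\<close>)
      ultimately have "T 0 b = X i 0"
        using b finI by (simp add: T_def)
      then show ?thesis by (metis rangeI)
    qed
    then have "V 0 \<subseteq> range (T 0)"
      unfolding VX[OF U(2)] by (intro span_minimal sub) auto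
    moreover have "Basis - I \<subseteq> range (T 0)"
    proof
      fix j assume j: "j \<in> Basis - I"
      have z: "j \<bullet> b = 0" if "b \<in> I" for b
        using j that I(1) by (intro inner_not_same_Basis) auto
      then have "T 0 j = j"
        by (simp add: T_def coord_proj_def)
      then show "j \<in> range (T 0)" by (metis rangeI)
    qed
    ultimately have "span (V 0 \<union> (Basis - I)) \<subseteq> range (T 0)"
      by (intro span_minimal sub) auto
    then show ?thesis using I(3) by auto
  qed
  then have "inj (T 0)"
    by (rule linear_surjective_imp_injective[OF linT]) (rule refl)
  then obtain c where c: "0 < c" "\<And>u. c * norm u \<le> norm (T 0 u)"
    using linear_inj_bounded_below_pos[OF linT] by metis
  \<comment> \<open>So close to \<open>0\<close>, \<open>T y\<close> differs from \<open>T 0\<close> by at most half of the lower bound \<open>c\<close>.\<close>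
  define \<delta> where "\<delta> = min \<delta>1 (c / (2 * (K + 1)))"
  have \<delta>: "0 < \<delta>" using \<delta>1 c K by (simp add: \<delta>_def)
  have ball: "cball 0 \<delta> \<subseteq> cball 0 \<delta>1" by (auto simp: \<delta>_def)
  have below: "c / 2 * norm u \<le> norm (T y u)" if y: "y \<in> cball 0 \<delta>" for y u
  proof -
    have "K * norm y \<le> K * (c / (2 * (K + 1)))"
      using y K by (intro mult_left_mono) (auto simp: \<delta>_def)
    also have "\<dots> \<le> c / 2"
      using K c by (simp add: field_simps)
    finally have Ky: "K * norm y \<le> c / 2" .
    have "norm (T 0 u - T y u) \<le> K * norm (0 - y) * norm u"
      using subsetD[OF ball y] \<delta>1 by (intro T_lip) auto
    also have "\<dots> \<le> c / 2 * norm u"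
      using Ky by (intro mult_right_mono) auto
    finally have "norm (T 0 u - T y u) \<le> c / 2 * norm u" .
    moreover have "norm (T 0 u) \<le> norm (T y u) + norm (T 0 u - T y u)"
      by (rule norm_triangle_sub)
    moreover have "c * norm u = c / 2 * norm u + c / 2 * norm u" by (simp add: field_simps)
    ultimately show ?thesis using c(2)[of u] by linarith
  qed
  have injT: "inj (T y)" if y: "y \<in> cball 0 \<delta>" for y
  proof -
    have "u = 0" if "T y u = 0" for u
      using below[OF y, of u] that c(1) by (simp add: mult_le_0_iff)
    then show ?thesis by (simp add: linear_injective_0[OF linT])
  qed
  define S where "S y = inv (T y)" for y
  have linS: "linear (S y)" and TS: "\<And>u. T y (S y u) = u" and ST: "\<And>u. S y (T y u) = u"
    if y: "y \<in> cball 0 \<delta>" for y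
  proof -
    show "linear (S y)"
      unfolding S_def using linT injT[OF y] by (rule inj_linear_imp_inv_linear)
    have "surj (T y)"
      using linT injT[OF y] by (rule linear_injective_imp_surjective) (rule refl)
    then show "T y (S y u) = u" for u
      unfolding S_def by (rule surj_f_inv_f)
    show "S y (T y u) = u" for u
      unfolding S_def using injT[OF y] by simp
  qed
  have normS: "norm (S y u) \<le> 2 / c * norm u" if y: "y \<in> cball 0 \<delta>" for y u
    using below[OF y, of "S y u"] c(1) by (simp add: TS[OF y] field_simps)
  have S_lip: "norm (S y u - S z u) \<le> (2 / c) * (K * norm (y - z) * (2 / c * norm u))"
    if y: "y \<in> cball 0 \<delta>" and z: "z \<in> cball 0 \<delta>" for y z u
  proof -
    \<comment> \<open>The resolvent identity, which transfers the Lipschitz bound from \<open>T\<close> to its inverse.\<close>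
    have "S y u - S z u = S y (T z (S z u) - T y (S z u))"
      using TS[OF z] ST[OF y] by (simp add: linear_diff[OF linS[OF y]])
    also have "norm \<dots> \<le> 2 / c * norm (T z (S z u) - T y (S z u))"
      by (rule normS[OF y])
    also have "\<dots> \<le> 2 / c * (K * norm (z - y) * norm (S z u))"
      using subsetD[OF ball y] subsetD[OF ball z] c(1) by (intro mult_left_mono T_lip) auto
    also have "\<dots> \<le> 2 / c * (K * norm (z - y) * (2 / c * norm u))"
      using normS[OF z] c(1) K by (intro mult_left_mono) auto
    finally show ?thesis by (simp add: norm_minus_commute)
  qed
  \<comment> \<open>Outside the ball \<open>T y\<close> need not be invertible; the value \<open>0\<close> satisfies the algebraic requirements.\<close>
  define M where "M y = (if y \<in> cball 0 \<delta> then Blinfun (\<lambda>u. ?P (S y (?P u)) - S y (?P u)) else 0)" for y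
  have M: "blinfun_apply (M y) u = ?P (S y (?P u)) - S y (?P u)" if y: "y \<in> cball 0 \<delta>" for y u
  proof -
    have blS: "bounded_linear (S y)"
      using linS[OF y] by (simp add: linear_conv_bounded_linear)
    have "bounded_linear (\<lambda>u. ?P (S y (?P u)) - S y (?P u))"
      by (intro bounded_linear_sub bounded_linear_compose[OF bounded_linear_coord_proj]
          bounded_linear_compose[OF blS] bounded_linear_coord_proj)
    then show ?thesis
      using y by (simp add: M_def bounded_linear_Blinfun_apply)
  qed
  have nP: "norm (?P w - w) \<le> (real k + 1) * norm w" for w
    using norm_triangle_ineq4[of "?P w" w] norm_coord_proj_le[OF I(1), of w] I(2) by (simp add: algebra_simps)
  have nP': "norm (?P w) \<le> real k * norm w" for w
    using norm_coord_proj_le[OF I(1), of w] I(2) by simp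
  show ?thesis
  proof (rule that[OF I(1,2) \<delta>])
    show "0 \<le> (real k + 1) * (2 / c * real k)"
      "0 \<le> (real k + 1) * ((2 / c) * (K * (2 / c * real k)))"
      using c(1) K by auto
    show "norm (M y) \<le> (real k + 1) * (2 / c * real k)" if y: "y \<in> cball 0 \<delta>" for y
    proof (rule norm_blinfun_bound)
      show "0 \<le> (real k + 1) * (2 / c * real k)" using c(1) by simp
      fix u
      have "norm (M y u) \<le> (real k + 1) * norm (S y (?P u))"
        unfolding M[OF y] by (rule nP)
      also have "\<dots> \<le> (real k + 1) * (2 / c * norm (?P u))"
        by (intro mult_left_mono normS[OF y]) simp
      also have "\<dots> \<le> (real k + 1) * (2 / c * (real k * norm u))"
        using c(1) by (intro mult_left_mono nP') auto
      finally show "norm (M y u) \<le> (real k + 1) * (2 / c * real k) * norm u"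
        by (simp add: mult_ac)
    qed
    show "norm (M y - M z) \<le> (real k + 1) * ((2 / c) * (K * (2 / c * real k))) * norm (y - z)"
      if y: "y \<in> cball 0 \<delta>" and z: "z \<in> cball 0 \<delta>" for y z
    proof (rule norm_blinfun_bound)
      show "0 \<le> (real k + 1) * ((2 / c) * (K * (2 / c * real k))) * norm (y - z)"
        using c(1) K by simp
      fix u
      let ?w = "S y (?P u) - S z (?P u)"
      have "(M y - M z) u = ?P ?w - ?w"
        by (simp add: blinfun.diff_left M[OF y] M[OF z] coord_proj_linear)
      then have "norm ((M y - M z) u) \<le> (real k + 1) * norm ?w"
        using nP by metis
      also have "\<dots> \<le> (real k + 1) * ((2 / c) * (K * norm (y - z) * (2 / c * norm (?P u))))"
        by (intro mult_left_mono S_lip[OF y z]) simp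
      also have "\<dots> \<le> (real k + 1) * ((2 / c) * (K * norm (y - z) * (2 / c * (real k * norm u))))"
        using c(1) K by (intro mult_left_mono nP') auto
      finally show "norm ((M y - M z) u) \<le> (real k + 1) * ((2 / c) * (K * (2 / c * real k))) * norm (y - z) * norm u"
        by (simp only: mult_ac)
    qed
    show "M y (?P u) = M y u" for y u
    proof (cases "y \<in> cball 0 \<delta>")
      case True
      then show ?thesis by (simp only: M coord_proj_idem[OF I(1)])
    next
      case False
      then have "M y = 0" unfolding M_def by (rule if_not_P)
      then show ?thesis by simp
    qed
    show "?P (M y u) = 0" for y u
    proof (cases "y \<in> cball 0 \<delta>")
      case True
      then show ?thesis by (simp only: M coord_proj_linear coord_proj_idem[OF I(1)]) simp
    next
      case False
      then have "M y = 0" unfolding M_def by (rule if_not_P)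
      then show ?thesis by (simp add: coord_proj_linear)
    qed
    show "V y = range (\<lambda>u. ?P u + M y u)" if y: "y \<in> cball 0 \<delta>" for y
    proof -
      let ?N = "\<lambda>u. ?P u + M y u"
      have yU: "y \<in> U" using y ball \<delta>1(3) by blast
      have bl: "bounded_linear ?N"
        by (intro bounded_linear_add bounded_linear_coord_proj blinfun.bounded_linear_right)
      have sub: "subspace (range ?N)"
        by (intro linear_subspace_image bounded_linear.linear[OF bl] subspace_UNIV)
      have in_V: "range ?N \<subseteq> V y"
      proof (rule image_subsetI)
        fix u
        let ?w = "S y (?P u)"
        have "?P u = (\<Sum>b\<in>I. (?w \<bullet> b) *\<^sub>R X (h b) y) + (?w - ?P ?w)"
          using TS[OF y, of "?P u"] by (simp add: T_def)
        then have "?N u = (\<Sum>b\<in>I. (?w \<bullet> b) *\<^sub>R X (h b) y)"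
          unfolding M[OF y] by (simp add: algebra_simps)
        also have "\<dots> \<in> span {X i y |i. i < k}"
          by (intro span_sum span_scale span_base) (use hk in blast)
        finally show "?N u \<in> V y" by (simp only: VX[OF yU])
      qed
      have "?P ` range ?N = range ?P"
      proof -
        have "?P (?N u) = ?P u" for u
        proof -
          have "?P (M y u) = 0"
            by (simp only: M[OF y] coord_proj_linear coord_proj_idem[OF I(1)]) simp
          then show ?thesis
            by (simp add: coord_proj_linear coord_proj_idem[OF I(1)])
        qed
        then show ?thesis by (simp add: image_image)
      qed
      then have "dim (range ?P) \<le> dim (range ?N)"
        using dim_image_le[OF bounded_linear.linear[OF bounded_linear_coord_proj], of I "range ?N"] by simp
      then have "dim (V y) \<le> dim (range ?N)"
        using dim_range_coord_proj[OF I(1)] I(2) dimV by (metis order_trans)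
      then show ?thesis
        using subspace_dim_equal[OF sub subV in_V] by simp
    qed
  qed
qed

section \<open>Graphs over coordinate planes\<close>

lemma C1_holder_on_UNIV:
  assumes "\<And>x. (f has_derivative blinfun_apply (f' x)) (at x)"
    and "\<And>x y. norm (f' x - f' y) \<le> C * dist x y powr \<alpha>"
  shows "C1_holder_on \<alpha> UNIV f"
proof -
  have "\<exists>r>0. \<exists>C. \<forall>y\<in>ball x r \<inter> UNIV. \<forall>z\<in>ball x r \<inter> UNIV. norm (f' y - f' z) \<le> C * dist y z powr \<alpha>" for x
    using assms(2) zero_less_one by blast
  then show ?thesis
    unfolding C1_holder_on_def using assms(1) by blast
qed

lemma continuous_on_if_holder:
  fixes f :: "'a::metric_space \<Rightarrow> 'b::real_normed_vector"
  assumes "0 < \<alpha>" and holder: "\<And>x y. norm (f x - f y) \<le> C * dist x y powr \<alpha>"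
  shows "continuous_on UNIV f"
proof (intro continuous_at_imp_continuous_on ballI)
  fix x :: 'a
  have "((\<lambda>y. C * dist y x powr \<alpha>) \<longlongrightarrow> C * (0 powr \<alpha>)) (at x)"
    by (intro tendsto_mult tendsto_const tendsto_powr2)
      (use assms(1) in \<open>auto intro!: tendsto_dist_iff[THEN iffD1] tendsto_ident_at\<close>)
  then have "((\<lambda>y. C * dist y x powr \<alpha>) \<longlongrightarrow> 0) (at x)"
    using assms(1) by simp
  then have "((\<lambda>y. f y - f x) \<longlongrightarrow> 0) (at x)"
    by (rule Lim_null_comparison[rotated]) (intro always_eventually allI holder)
  then show "isCont f x"
    unfolding isCont_def by (rule LIM_zero_cancel)
qed

text \<open>A graph over the span of \<open>I\<close> is described by a function on the whole space that depends only on the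
coordinates in \<open>I\<close>. Then \<open>x \<mapsto> x + f x\<close> is a shear of the space, with inverse \<open>x \<mapsto> x - f x\<close>, that
flattens the graph globally.\<close>

locale coordinate_graph =
  fixes I :: "'a::euclidean_space set" and f :: "'a \<Rightarrow> 'a" and f' :: "'a \<Rightarrow> 'a \<Rightarrow>\<^sub>L 'a"
  assumes I: "I \<subseteq> Basis"
    and der: "(f has_derivative blinfun_apply (f' x)) (at x)"
    and f_coord_proj: "f (coord_proj I x) = f x"
    and coord_proj_f: "coord_proj I (f x) = 0"
begin

definition lift :: "'a \<Rightarrow> 'a" where
  "lift x = coord_proj I x + f x"

definition graph :: "'a set" where
  "graph = range lift"

lemma coord_proj_lift: "coord_proj I (lift x) = coord_proj I x"
  by (simp add: lift_def coord_proj_linear coord_proj_idem[OF I] coord_proj_f)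

lemma f_lift: "f (lift x) = f x"
  by (metis coord_proj_lift f_coord_proj)

lemma graph_iff: "y \<in> graph \<longleftrightarrow> y = coord_proj I y + f y"
  unfolding graph_def by (metis (no_types) coord_proj_lift f_lift lift_def rangeE rangeI)

lemma f'_coord_proj: "f' (coord_proj I x) (coord_proj I u) = f' x u"
proof -
  have "((\<lambda>x. f (coord_proj I x)) has_derivative (\<lambda>u. f' (coord_proj I x) (coord_proj I u))) (at x)"
    by (rule has_derivative_compose[OF bounded_linear_imp_has_derivative[OF bounded_linear_coord_proj] der])
  then have "(f has_derivative (\<lambda>u. f' (coord_proj I x) (coord_proj I u))) (at x)"
    by (simp only: f_coord_proj)
  from has_derivative_unique[OF this der] show ?thesis by (rule fun_cong)
qed

lemma f'_lift: "f' (lift x) u = f' x u"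
  by (metis coord_proj_lift f'_coord_proj)

lemma dim_range_coord_proj_eq: "dim (range (coord_proj I)) = card I"
proof (rule antisym)
  have "finite I" using I finite_Basis finite_subset by blast
  have "range (coord_proj I) \<subseteq> span I"
    unfolding coord_proj_def by (intro image_subsetI span_sum span_scale span_base)
  then show "dim (range (coord_proj I)) \<le> card I"
    using \<open>finite I\<close> by (rule dim_le_card)
qed (rule dim_range_coord_proj[OF I])

lemma graph_submanifold:
  assumes holder: "\<And>x y. norm (f' x - f' y) \<le> C * dist x y powr \<alpha>"
  shows "C1_holder_submanifold \<alpha> (card I) graph"
proof -
  let ?\<phi> = "\<lambda>x. x - f x" and ?\<psi> = "\<lambda>x. x + f x"
  have inverse: "?\<phi> (?\<psi> x) = x" "?\<psi> (?\<phi> x) = x" for x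
  proof -
    have "f (x + f x) = f x" "f (x - f x) = f x"
      using f_coord_proj[of "x + f x"] f_coord_proj[of "x - f x"] f_coord_proj[of x]
      by (simp_all add: coord_proj_linear coord_proj_f)
    then show "?\<phi> (?\<psi> x) = x" "?\<psi> (?\<phi> x) = x" by simp_all
  qed
  have der': "(?\<phi> has_derivative blinfun_apply (id_blinfun - f' x)) (at x)"
    "(?\<psi> has_derivative blinfun_apply (id_blinfun + f' x)) (at x)" for x
    by (auto intro!: derivative_eq_intros der simp: blinfun.bilinear_simps)
  have cont: "continuous_on UNIV ?\<phi>" "continuous_on UNIV ?\<psi>"
    by (intro continuous_at_imp_continuous_on ballI has_derivative_continuous[OF der'(1)]
        has_derivative_continuous[OF der'(2)])+
  have homeo: "homeomorphism UNIV UNIV ?\<phi> ?\<psi>"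
    using inverse cont by (intro homeomorphismI) auto
  have "C1_holder_on \<alpha> UNIV ?\<phi>"
    by (rule C1_holder_on_UNIV[OF der'(1)]) (use holder in \<open>simp add: norm_minus_commute\<close>)
  moreover have "C1_holder_on \<alpha> UNIV ?\<psi>"
    by (rule C1_holder_on_UNIV[OF der'(2)]) (use holder in simp)
  moreover have "subspace (range (coord_proj I))"
    by (intro linear_subspace_image bounded_linear.linear[OF bounded_linear_coord_proj] subspace_UNIV)
  moreover have "?\<phi> ` graph = range (coord_proj I)"
  proof -
    have "?\<phi> (lift x) = coord_proj I x" for x
      by (simp only: f_lift) (simp add: lift_def)
    then show ?thesis by (simp add: graph_def image_image)
  qed
  ultimately show ?thesis
    unfolding C1_holder_submanifold_def using homeo dim_range_coord_proj_eq
    by (intro ballI exI[of _ UNIV] exI[of _ "range (coord_proj I)"] exI[of _ ?\<phi>] exI[of _ ?\<psi>]) simp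
qed

text \<open>A curve in the graph satisfies \<open>\<gamma> = P \<gamma> + f \<gamma>\<close>; differentiating shows that its velocity is
in the graph of \<open>f' x\<close>. Conversely, lifting a straight line realizes each vector of that graph.\<close>

lemma tangent_space_graph:
  assumes cont: "continuous_on UNIV f'"
  shows "tangent_space graph (lift x) = range (\<lambda>u. coord_proj I u + f' x u)"
proof (intro equalityI subsetI)
  fix v assume "v \<in> tangent_space graph (lift x)"
  then obtain \<gamma> \<epsilon> where \<epsilon>: "0 < \<epsilon>" and \<gamma>: "\<gamma> ` {-\<epsilon><..<\<epsilon>} \<subseteq> graph" "\<gamma> 0 = lift x"
    and v: "(\<gamma> has_vector_derivative v) (at 0)"
    by (auto simp: tangent_space_def)
  have "((\<lambda>t. coord_proj I (\<gamma> t) + f (\<gamma> t)) has_derivative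
      (\<lambda>t. coord_proj I (t *\<^sub>R v) + f' (lift x) (t *\<^sub>R v))) (at 0)"
    using v unfolding has_vector_derivative_def \<gamma>(2)[symmetric]
    by (intro has_derivative_add has_derivative_compose[OF _ der]
        bounded_linear.has_derivative[OF bounded_linear_coord_proj])
  then have d: "((\<lambda>t. coord_proj I (\<gamma> t) + f (\<gamma> t)) has_vector_derivative (coord_proj I v + f' x v)) (at 0)"
    by (simp add: has_vector_derivative_def coord_proj_linear blinfun.scaleR_right f'_lift scaleR_add_right)
  have eq: "coord_proj I (\<gamma> t) + f (\<gamma> t) = \<gamma> t" if "t \<in> {-\<epsilon><..<\<epsilon>}" for t
  proof -
    have "\<gamma> t \<in> graph" using \<gamma>(1) that by blast
    then show ?thesis unfolding graph_iff by (rule sym)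
  qed
  have "(\<gamma> has_vector_derivative (coord_proj I v + f' x v)) (at 0)"
    by (rule has_vector_derivative_transform_within_open[OF d open_greaterThanLessThan _ eq]) (use \<epsilon> in simp_all)
  from vector_derivative_unique_at[OF v this]
  show "v \<in> range (\<lambda>u. coord_proj I u + f' x u)"
    by (rule image_eqI) (rule UNIV_I)
next
  fix v assume "v \<in> range (\<lambda>u. coord_proj I u + f' x u)"
  then obtain u where u: "v = coord_proj I u + f' x u" by blast
  define \<gamma> where "\<gamma> t = lift (x + t *\<^sub>R u)" for t
  have \<gamma>: "(\<gamma> has_vector_derivative (coord_proj I u + f' (x + t *\<^sub>R u) u)) (at t)" for t
  proof -
    have lin: "((\<lambda>t. x + t *\<^sub>R u) has_derivative (\<lambda>s. s *\<^sub>R u)) (at t)"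
      by (auto intro!: derivative_eq_intros)
    have "(\<gamma> has_derivative (\<lambda>s. coord_proj I (s *\<^sub>R u) + f' (x + t *\<^sub>R u) (s *\<^sub>R u))) (at t)"
      unfolding \<gamma>_def[abs_def] lift_def
      by (intro has_derivative_add has_derivative_compose[OF lin der]
          bounded_linear.has_derivative[OF bounded_linear_coord_proj] lin)
    then show ?thesis
      by (simp add: has_vector_derivative_def coord_proj_linear blinfun.scaleR_right scaleR_add_right)
  qed
  have "continuous_on {-1<..<1} (\<lambda>t. coord_proj I u + f' (x + t *\<^sub>R u) u)"
    by (intro continuous_intros continuous_on_compose2[OF cont]) auto
  then have "\<gamma> C1_differentiable_on {-1<..<1}"
    unfolding C1_differentiable_on_def
    using \<gamma> by (intro exI[of _ "\<lambda>t. coord_proj I u + f' (x + t *\<^sub>R u) u"]) simp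
  moreover have "(\<gamma> has_vector_derivative v) (at 0)"
    using \<gamma>[of 0] by (simp add: u)
  moreover have "\<gamma> ` {-1<..<1} \<subseteq> graph" "\<gamma> 0 = lift x"
    by (auto simp: \<gamma>_def graph_def)
  ultimately show "v \<in> tangent_space graph (lift x)"
    unfolding tangent_space_def by (intro CollectI exI[of _ \<gamma>] exI[of _ "1 :: real"]) simp
qed

end

theorem theorem1p1p6:
  fixes V :: "real ^ 'n \<Rightarrow> (real ^ 'n) set" and k :: nat
  assumes "C1_plane_distribution k V"
  shows "\<exists>S :: (real ^ 'n) set.
           (\<forall>\<alpha>. 0 < \<alpha> \<and> \<alpha> < 1 \<longrightarrow> C1_holder_submanifold \<alpha> k S) \<and>
           hausdorff_measure k (tangency_set S V) > 0"
proof (rule plane_distribution_graph[OF assms])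
  fix I M \<delta> m L
  assume I_Basis: "I \<subseteq> Basis" and card_I: "card I = k" and \<delta>: "0 < \<delta>" and m: "0 \<le> m" and L: "0 \<le> L"
    and M: "\<And>y. y \<in> cball 0 \<delta> \<Longrightarrow> norm (M y :: (real ^ 'n) \<Rightarrow>\<^sub>L (real ^ 'n)) \<le> m"
      "\<And>y z. y \<in> cball 0 \<delta> \<Longrightarrow> z \<in> cball 0 \<delta> \<Longrightarrow> norm (M y - M z) \<le> L * norm (y - z)"
      "\<And>y u. M y (coord_proj I u) = M y u" "\<And>y u. coord_proj I (M y u) = 0"
    and V: "\<And>y. y \<in> cball 0 \<delta> \<Longrightarrow> V y = range (\<lambda>u. coord_proj I u + M y u)"
  \<comment> \<open>The summand \<open>1\<close> keeps the denominator positive when \<open>k = 0\<close>.\<close>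
  define \<rho> where "\<rho> = \<delta> / (2 * ((1 + m) * k + 1))"
  have pos: "0 < (1 + m) * k + 1"
    using m by (intro add_nonneg_pos) auto
  have \<rho>: "0 < \<rho>" using \<delta> pos by (simp add: \<rho>_def)
  have "(1 + m) * card I * (2 * \<rho>) \<le> ((1 + m) * k + 1) * (2 * \<rho>)"
    using card_I \<rho> by (intro mult_right_mono) auto
  also have "\<dots> = \<delta>"
  proof -
    have "c * (2 * (\<delta> / (2 * c))) = \<delta>" if "0 < c" for c
      using that by simp
    from this[OF pos] show ?thesis by (simp only: \<rho>_def)
  qed
  finally have small: "(1 + m) * card I * (2 * \<rho>) \<le> \<delta>" .
  interpret euler_scheme \<rho> I M \<delta> m L
    by unfold_locales (use \<rho> I_Basis M m L small in auto)
  interpret coordinate_graph I graph_fun graph_deriv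
    by unfold_locales
      (use I_Basis graph_fun_regularity(3) graph_fun_coord_proj coord_proj_graph_fun in auto)
  have "C1_holder_submanifold \<alpha> k graph" if \<alpha>: "0 < \<alpha>" "\<alpha> < 1" for \<alpha>
    using graph_fun_regularity(4)[OF \<alpha>] graph_submanifold card_I by metis
  moreover have "0 < hausdorff_measure k (tangency_set graph V)"
    unfolding card_I[symmetric]
  proof (rule hausdorff_measure_pos_if_projection[OF I_Basis])
    show "cantor_set \<in> sets borel"
      by (rule borel_closed[OF closed_cantor_set])
    show "0 < emeasure lborel cantor_set"
      by (rule less_le_trans[OF _ emeasure_cantor_set]) (use \<rho> in simp)
    fix x :: "real ^ 'n" assume "\<And>b. b \<in> I \<Longrightarrow> x \<bullet> b \<in> cantor_set"
    then have x: "x \<in> cantor_points" by (simp add: cantor_points_def)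
    obtain C where "\<And>x y. norm (graph_deriv x - graph_deriv y) \<le> C * dist x y powr (1/2)"
      using graph_fun_regularity(4)[of "1/2"] by auto
    then have "continuous_on UNIV graph_deriv"
      by (intro continuous_on_if_holder[where \<alpha> = "1/2"]) auto
    then have "tangent_space graph (lift x) = range (\<lambda>u. coord_proj I u + graph_deriv x u)"
      by (rule tangent_space_graph)
    also have "\<dots> = V (lift x)"
      unfolding V[OF graph_fun_on_cantor_points(1)[OF x, folded lift_def]] graph_fun_on_cantor_points(2)[OF x, folded lift_def] ..
    finally have "lift x \<in> tangency_set graph V"
      by (simp add: tangency_set_def graph_def)
    moreover have "lift x \<bullet> b = x \<bullet> b" if "b \<in> I" for b
      using that I_Basis coord_proj_inner[OF I_Basis, of b "lift x"] coord_proj_inner[OF I_Basis, of b x]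
      by (auto simp: coord_proj_lift)
    ultimately show "\<exists>y\<in>tangency_set graph V. \<forall>b\<in>I. y \<bullet> b = x \<bullet> b"
      by blast
  qed
  ultimately show ?thesis by blast
qed

end
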